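(* Let $(X,\sigma_X)$, $(Y,\sigma_Y)$ be one-sided subshifts, $\pi:X\to Y$ a one-block factor map, and suppose $X$ has the specification property. Let $\mathcal F=\{\log f_n\}$ be an almost additive potential on $X$ with bounded variation, $\mu$ its unique invariant Gibbs measure (which is its unique equilibrium state), and $\nu=\pi\mu$. Then $P_Y(\tilde{\mathcal G})=0$, $\nu$ is the unique invariant Gibbs measure for $\tilde{\mathcal G}=\{\log\tilde g_n\}$ on $Y$, and $\nu$ is the unique equilibrium state for $\tilde{\mathcal G}$.
   Context: Subshifts: one-sided closed shift-invariant subsets of $\{1,\dots,k\}^{\mathbb N}$ with shift and metric $d(x,x')=2^{-j}$, $j$ the longest common prefix length. Specification: $\exists p>0$ such that for all allowable $u,v$ there is $w$ of length $p$ with $uwv$ allowable. Factor map: continuous surjection commuting with shifts, one-block. Almost additive: $\exists C>0$, $e^{-C}f_n(x)f_m(\sigma^nx)\le f_{n+m}(x)\le e^Cf_n(x)f_m(\sigma^nx)$; bounded variation: $\sup_n\sup\{f_n(x)/f_n(x'):x_i=x'_i,1\le i\le n\}<\infty$. Pressure of a sequence $\Phi=\{\log\phi_n\}$: $P(\Phi)=\lim_{\epsilon\to0}\limsup_n\frac1n\log\sup_E\sum_{x\in E}\phi_n(x)$ over $(n,\epsilon)$-separated sets. Gibbs measure for $\Phi$: $\exists C_0$ with $C_0^{-1}<\mu([x_1\cdots x_n])/(e^{-nP(\Phi)}\phi_n(x))<C_0$ for all $x,n$. Equilibrium state: invariant measure maximizing $h_\mu+\lim_n\frac1n\int\log\phi_nd\mu$.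 $E_n(y)$: any set with exactly one point from each cylinder $[x_1\cdots x_n]$ of $X$ with $\pi([x_1\cdots x_n])\subseteq[y_1\cdots y_n]$; $g_n(y)=\sup_{E_n(y)}\sum_{x\in E_n(y)}f_n(x)$; $\tilde g_n=g_ne^{-nP_X(\mathcal F)}$. *)

theory Defs
  imports "HOL-Probability.Probability"
begin

text \<open>Points of the full shift are sequences nat => nat, indexed from 0
  (the paper's x_1 x_2 ... is x 0, x 1, ...). The topology on nat => nat is the
  product topology (nat discrete), which coincides with the metric topology of d.\<close>

definition shift :: "(nat \<Rightarrow> 'a) \<Rightarrow> (nat \<Rightarrow> 'a)" where
  "shift x = (\<lambda>i. x (Suc i))"

definition subshift :: "nat \<Rightarrow> (nat \<Rightarrow> nat) set \<Rightarrow> bool" where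
  "subshift k X \<longleftrightarrow> X \<noteq> {} \<and> X \<subseteq> {x. \<forall>i. x i \<in> {1..k}} \<and> closed X \<and> shift ` X \<subseteq> X"

definition sdist :: "(nat \<Rightarrow> nat) \<Rightarrow> (nat \<Rightarrow> nat) \<Rightarrow> real" where
  "sdist x y = (if x = y then 0 else (1/2) ^ (LEAST i. x i \<noteq> y i))"

definition allowable :: "(nat \<Rightarrow> nat) set \<Rightarrow> nat list \<Rightarrow> bool" where
  "allowable X w \<longleftrightarrow> (\<exists>x\<in>X. \<exists>j. \<forall>i<length w. x (j + i) = w ! i)"

definition has_specification :: "(nat \<Rightarrow> nat) set \<Rightarrow> bool" where
  "has_specification X \<longleftrightarrow> (\<exists>p>0. \<forall>u v. allowable X u \<and> allowable X v \<longrightarrow>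
      (\<exists>w. length w = p \<and> allowable X (u @ w @ v)))"

definition cyl :: "(nat \<Rightarrow> nat) set \<Rightarrow> nat \<Rightarrow> (nat \<Rightarrow> nat) \<Rightarrow> (nat \<Rightarrow> nat) set" where
  "cyl X n x = {y\<in>X. \<forall>i<n. y i = x i}"

text \<open>one-block factor map pi x = a o x from X onto Y (continuity and commuting with
  the shift are automatic for one-block maps)\<close>
definition one_block_factor :: "(nat \<Rightarrow> nat) set \<Rightarrow> (nat \<Rightarrow> nat) set \<Rightarrow> (nat \<Rightarrow> nat) \<Rightarrow> bool" where
  "one_block_factor X Y a \<longleftrightarrow> (\<lambda>x. a \<circ> x) ` X = Y"

definition potential_seq :: "(nat \<Rightarrow> nat) set \<Rightarrow> (nat \<Rightarrow> (nat \<Rightarrow> nat) \<Rightarrow> real) \<Rightarrow> bool" where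
  "potential_seq X f \<longleftrightarrow> (\<forall>n\<ge>1. continuous_on X (f n) \<and> (\<forall>x\<in>X. f n x > 0))"

definition almost_additive :: "(nat \<Rightarrow> nat) set \<Rightarrow> (nat \<Rightarrow> (nat \<Rightarrow> nat) \<Rightarrow> real) \<Rightarrow> bool" where
  "almost_additive X f \<longleftrightarrow> (\<exists>C>0. \<forall>n\<ge>1. \<forall>m\<ge>1. \<forall>x\<in>X.
      exp (- C) * f n x * f m ((shift ^^ n) x) \<le> f (n + m) x \<and>
      f (n + m) x \<le> exp C * f n x * f m ((shift ^^ n) x))"

definition bounded_variation :: "(nat \<Rightarrow> nat) set \<Rightarrow> (nat \<Rightarrow> (nat \<Rightarrow> nat) \<Rightarrow> real) \<Rightarrow> bool" where
  "bounded_variation X f \<longleftrightarrow> (\<exists>M. \<forall>n\<ge>1. \<forall>x\<in>X. \<forall>x'\<in>X.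
      (\<forall>i<n. x i = x' i) \<longrightarrow> f n x / f n x' \<le> M)"

definition separated :: "(nat \<Rightarrow> nat) set \<Rightarrow> nat \<Rightarrow> real \<Rightarrow> (nat \<Rightarrow> nat) set \<Rightarrow> bool" where
  "separated X n \<epsilon> E \<longleftrightarrow> finite E \<and> E \<subseteq> X \<and>
     (\<forall>x\<in>E. \<forall>y\<in>E. x \<noteq> y \<longrightarrow> (\<exists>i<n. sdist ((shift ^^ i) x) ((shift ^^ i) y) > \<epsilon>))"

definition pressure :: "(nat \<Rightarrow> nat) set \<Rightarrow> (nat \<Rightarrow> (nat \<Rightarrow> nat) \<Rightarrow> real) \<Rightarrow> ereal" where
  "pressure X \<phi> = Lim (at_right (0::real)) (\<lambda>\<epsilon>. Limsup sequentially (\<lambda>n.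
      ereal (ln (Sup {(\<Sum>x\<in>E. \<phi> n x) | E. separated X n \<epsilon> E}) / real n)))"

definition prob_on :: "(nat \<Rightarrow> nat) set \<Rightarrow> (nat \<Rightarrow> nat) measure \<Rightarrow> bool" where
  "prob_on X \<mu> \<longleftrightarrow> prob_space \<mu> \<and> sets \<mu> = sets (restrict_space borel X)"

definition invariant_measure :: "(nat \<Rightarrow> nat) set \<Rightarrow> (nat \<Rightarrow> nat) measure \<Rightarrow> bool" where
  "invariant_measure X \<mu> \<longleftrightarrow> prob_on X \<mu> \<and>
     (\<forall>A\<in>sets \<mu>. emeasure \<mu> (shift -` A \<inter> X) = emeasure \<mu> A)"

definition gibbs :: "(nat \<Rightarrow> nat) set \<Rightarrow> (nat \<Rightarrow> (nat \<Rightarrow> nat) \<Rightarrow> real) \<Rightarrow> (nat \<Rightarrow> nat) measure \<Rightarrow> bool" where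
  "gibbs X \<phi> \<mu> \<longleftrightarrow> (\<exists>P C0. pressure X \<phi> = ereal P \<and> C0 > 0 \<and>
     (\<forall>n\<ge>1. \<forall>x\<in>X.
        inverse C0 < measure \<mu> (cyl X n x) / (exp (- (real n * P)) * \<phi> n x) \<and>
        measure \<mu> (cyl X n x) / (exp (- (real n * P)) * \<phi> n x) < C0))"

definition meas_partition :: "(nat \<Rightarrow> nat) set \<Rightarrow> (nat \<Rightarrow> nat) measure \<Rightarrow> (nat \<Rightarrow> nat) set set \<Rightarrow> bool" where
  "meas_partition X \<mu> \<xi> \<longleftrightarrow> finite \<xi> \<and> \<xi> \<subseteq> sets \<mu> \<and> disjoint \<xi> \<and> \<Union>\<xi> = X"

definition join_part :: "(nat \<Rightarrow> nat) set \<Rightarrow> (nat \<Rightarrow> nat) set set \<Rightarrow> nat \<Rightarrow> (nat \<Rightarrow> nat) set set" where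
  "join_part X \<xi> n = {(\<Inter>i<n. (shift ^^ i) -` A i) \<inter> X | A. \<forall>i<n. A i \<in> \<xi>}"

definition part_entropy :: "(nat \<Rightarrow> nat) measure \<Rightarrow> (nat \<Rightarrow> nat) set set \<Rightarrow> real" where
  "part_entropy \<mu> \<xi> = (\<Sum>C\<in>\<xi>. - (measure \<mu> C * ln (measure \<mu> C)))"

definition entropy_rate :: "(nat \<Rightarrow> nat) set \<Rightarrow> (nat \<Rightarrow> nat) measure \<Rightarrow> (nat \<Rightarrow> nat) set set \<Rightarrow> real" where
  "entropy_rate X \<mu> \<xi> = lim (\<lambda>n. part_entropy \<mu> (join_part X \<xi> n) / real n)"

definition ks_entropy :: "(nat \<Rightarrow> nat) set \<Rightarrow> (nat \<Rightarrow> nat) measure \<Rightarrow> real" where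
  "ks_entropy X \<mu> = Sup {entropy_rate X \<mu> \<xi> | \<xi>. meas_partition X \<mu> \<xi>}"

definition free_energy :: "(nat \<Rightarrow> nat) set \<Rightarrow> (nat \<Rightarrow> (nat \<Rightarrow> nat) \<Rightarrow> real) \<Rightarrow> (nat \<Rightarrow> nat) measure \<Rightarrow> real" where
  "free_energy X \<phi> \<mu> = ks_entropy X \<mu> + lim (\<lambda>n. (\<integral>x. ln (\<phi> n x) \<partial>\<mu>) / real n)"

definition equilibrium_state :: "(nat \<Rightarrow> nat) set \<Rightarrow> (nat \<Rightarrow> (nat \<Rightarrow> nat) \<Rightarrow> real) \<Rightarrow> (nat \<Rightarrow> nat) measure \<Rightarrow> bool" where
  "equilibrium_state X \<phi> \<mu> \<longleftrightarrow> invariant_measure X \<mu> \<and>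
     (\<forall>\<mu>'. invariant_measure X \<mu>' \<longrightarrow> free_energy X \<phi> \<mu>' \<le> free_energy X \<phi> \<mu>)"

definition En_set :: "(nat \<Rightarrow> nat) set \<Rightarrow> (nat \<Rightarrow> nat) set \<Rightarrow> (nat \<Rightarrow> nat) \<Rightarrow> nat \<Rightarrow> (nat \<Rightarrow> nat) \<Rightarrow> (nat \<Rightarrow> nat) set \<Rightarrow> bool" where
  "En_set X Y a n y E \<longleftrightarrow> E \<subseteq> X \<and>
     (\<forall>x\<in>E. (\<lambda>z. a \<circ> z) ` cyl X n x \<subseteq> cyl Y n y) \<and>
     (\<forall>x\<in>X. (\<lambda>z. a \<circ> z) ` cyl X n x \<subseteq> cyl Y n y \<longrightarrow> card (E \<inter> cyl X n x) = 1)"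

definition gsum :: "(nat \<Rightarrow> nat) set \<Rightarrow> (nat \<Rightarrow> nat) set \<Rightarrow> (nat \<Rightarrow> nat) \<Rightarrow> (nat \<Rightarrow> (nat \<Rightarrow> nat) \<Rightarrow> real) \<Rightarrow> nat \<Rightarrow> (nat \<Rightarrow> nat) \<Rightarrow> real" where
  "gsum X Y a f n y = Sup {(\<Sum>x\<in>E. f n x) | E. En_set X Y a n y E}"

definition gtilde :: "(nat \<Rightarrow> nat) set \<Rightarrow> (nat \<Rightarrow> nat) set \<Rightarrow> (nat \<Rightarrow> nat) \<Rightarrow> (nat \<Rightarrow> (nat \<Rightarrow> nat) \<Rightarrow> real) \<Rightarrow> nat \<Rightarrow> (nat \<Rightarrow> nat) \<Rightarrow> real" where
  "gtilde X Y a f n y = gsum X Y a f n y * exp (- (real n * real_of_ereal (pressure X f)))"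

end

theory Submission
  imports Defs
begin

text \<open>Up to a constant factor \<open>gtilde n y\<close> is the \<open>\<nu>\<close>-measure of the n-cylinder of y, because the Gibbs property
  turns the defining sum into the total \<open>\<mu>\<close>-mass of the cylinders over it. This gives zero pressure and
  the Gibbs property. The free energy of an invariant measure N is then minus the rate of relative
  entropy of N against \<open>\<nu>\<close> on n-words, so it is at most 0, with value 0 at \<open>\<nu>\<close>. Since word entropies are
  subadditive and cylinder masses are submultiplicative up to a constant, zero free energy forces the
  relative entropies themselves to stay bounded in n; they are also bounded if N is Gibbs. A bound on
  them yields absolute continuity of N, and \<open>\<nu>\<close> is ergodic because a nontrivial invariant set would
  allow \<open>\<mu>\<close> to be reweighted into a second invariant Gibbs measure. Hence N is \<open>\<nu>\<close>.\<close>

section \<open>Shannon entropy of simple functions\<close>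

text \<open>The obstacle is that lifts of two adjacent words of Y cannot in general be concatenated,
  so the cylinder masses of \<open>\<nu>\<close> are known to satisfy only the upper half of
  quasi-multiplicativity. The argument on Y is arranged around that half. Word entropy and the
  integral of \<open>ln G\<close> are both subadditive up to a constant, and the limit in Fekete's
  lemma is an infimum. So n times the free energy is at most \<open>relEnt n N\<close> plus a
  constant for every n; a statement about limits alone would allow the relative entropy to grow
  sublinearly. The passage from bounded relative entropy to absolute continuity tests N against
  \<open>\<nu>\<close> tilted by a factor t on a set S: \<open>ln t\<close> times the N-mass of S is
  at most a constant plus t times its \<open>\<nu>\<close>-mass, uniformly in the length of the
  words defining S. Since \<open>ks_entropy\<close> is a supremum over all finite measurable
  partitions, the Kolmogorov-Sinai theorem is required before it can be compared with word
  entropies.\<close>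

lemma fekete_subadditive:
  fixes a :: "nat \<Rightarrow> real"
  assumes sub: "\<And>n m. n \<ge> 1 \<Longrightarrow> m \<ge> 1 \<Longrightarrow> a (n + m) \<le> a n + a m"
    and low: "\<And>n. n \<ge> 1 \<Longrightarrow> - c * real n \<le> a n"
  obtains L where "(\<lambda>n. a n / real n) \<longlonglongrightarrow> L" "\<And>n. n \<ge> 1 \<Longrightarrow> real n * L \<le> a n"
proof -
  define S where "S = (\<lambda>n. a n / real n) ` {1..}"
  \<comment> \<open>Naming the limit as an infimum yields the second conclusion, a bound at each
    fixed \<open>n\<close>.\<close>
  define L where "L = Inf S"
  have bdd: "bdd_below S"
    unfolding S_def by (rule bdd_belowI2[where m="-c"]) (use low in \<open>auto simp: field_simps\<close>)
  have L_le: "L \<le> a n / real n" if "n \<ge> 1" for n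
    unfolding L_def using that by (intro cInf_lower bdd) (auto simp: S_def)
  have mult: "a (q * N + r) \<le> real q * a N + a r" if "N \<ge> 1" "r \<ge> 1" for q N r
  proof (induction q)
    case (Suc q)
    have "a (Suc q * N + r) = a (N + (q * N + r))" by (simp add: algebra_simps)
    also have "\<dots> \<le> a N + a (q * N + r)" using that by (intro sub) auto
    finally show ?case using Suc by (simp add: algebra_simps)
  qed simp
  have "(\<lambda>n. a n / real n) \<longlonglongrightarrow> L"
  proof (rule LIMSEQ_I)
    fix e :: real assume e: "e > 0"
    have "S \<noteq> {}" by (auto simp: S_def)
    then obtain s where "s \<in> S" "s < L + e / 2"
      using cInf_lessD[of S "L + e / 2"] e by (auto simp: L_def)
    then obtain N where N: "N \<ge> 1" "a N / real N < L + e / 2" by (auto simp: S_def)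
    \<comment> \<open>\<open>B\<close> absorbs the remainder \<open>a r\<close> and the error of
      replacing \<open>q * N\<close> by \<open>n\<close>; summing over all remainders is a crude
      common bound.\<close>
    define B where "B = (\<Sum>r\<in>{1..N}. \<bar>a r\<bar> + \<bar>real r * (a N / real N)\<bar>)"
    have B: "\<bar>a r\<bar> + \<bar>real r * (a N / real N)\<bar> \<le> B" if "r \<in> {1..N}" for r
      unfolding B_def by (rule member_le_sum[OF that]) auto
    have "B \<ge> 0" unfolding B_def by (intro sum_nonneg) auto
    obtain n0 :: nat where n0: "real n0 > 2 * B / e" using reals_Archimedean2 by blast
    show "\<exists>no. \<forall>n\<ge>no. norm (a n / real n - L) < e"
    proof (intro exI[of _ "Suc n0"] allI impI)
      fix n assume n: "n \<ge> Suc n0"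
      \<comment> \<open>Dividing \<open>n - 1\<close> instead of \<open>n\<close> keeps the
        remainder in \<open>{1..N}\<close>, since subadditivity is assumed from index 1 on
        only.\<close>
      define q r where "q = (n - 1) div N" and "r = Suc ((n - 1) mod N)"
      have nqr: "n = q * N + r" "r \<in> {1..N}"
        using n N by (auto simp: q_def r_def Suc_le_eq)
      have "a n \<le> real q * a N + a r" unfolding nqr(1) using nqr(2) N by (intro mult) auto
      also have "real q * a N = real n * (a N / real N) - real r * (a N / real N)"
        using N nqr(1) by (simp add: field_simps)
      finally have "a n \<le> real n * (a N / real N) + B" using B[OF nqr(2)] by linarith
      then have "a n / real n \<le> a N / real N + B / real n"
        using n by (simp add: field_simps)
      moreover have "B / real n < e / 2"
      proof -
        have "2 * B / e < real n" using n n0 by linarith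
        then show ?thesis using e n by (simp add: field_simps)
      qed
      moreover have "L \<le> a n / real n" using n by (intro L_le) auto
      ultimately show "norm (a n / real n - L) < e"
        unfolding real_norm_def abs_less_iff using N(2) e by linarith
    qed
  qed
  moreover have "real n * L \<le> a n" if "n \<ge> 1" for n
    using L_le[OF that] that by (simp add: field_simps)
  ultimately show thesis using that by blast
qed

text \<open>Termwise this is \<open>ln s \<le> s - 1\<close> at \<open>s = q i / p i\<close>. The
  total mass of \<open>q\<close> is left free, so that tilted weights can be inserted later. The
  third assumption matters because \<open>ln 0 = 0\<close> would hide an infinite
  divergence.\<close>

lemma gibbs_inequality:
  fixes p q :: "'b \<Rightarrow> real"
  assumes "\<And>i. i \<in> I \<Longrightarrow> p i \<ge> 0" "\<And>i. i \<in> I \<Longrightarrow> q i \<ge> 0"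
    and "\<And>i. i \<in> I \<Longrightarrow> q i = 0 \<Longrightarrow> p i = 0"
  shows "(\<Sum>i\<in>I. p i * ln (q i)) + (\<Sum>i\<in>I. - (p i * ln (p i))) \<le> (\<Sum>i\<in>I. q i) - (\<Sum>i\<in>I. p i)"
proof -
  have "p i * ln (q i) + - (p i * ln (p i)) \<le> q i - p i" if i: "i \<in> I" for i
  proof (cases "p i = 0")
    case True then show ?thesis using assms(2)[OF i] by simp
  next
    case False
    then have pos: "p i > 0" "q i > 0"
      using assms(1,2)[OF i] assms(3)[OF i] by (auto simp: less_le)
    have "p i * ln (q i) + - (p i * ln (p i)) = p i * ln (q i / p i)"
      using pos by (simp add: ln_div algebra_simps)
    also have "\<dots> \<le> p i * (q i / p i - 1)"
      using pos by (intro mult_left_mono ln_le_minus_one) auto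
    also have "\<dots> = q i - p i" using pos by (simp add: field_simps)
    finally show ?thesis .
  qed
  then show ?thesis
    by (simp only: sum.distrib[symmetric] sum_subtractf[symmetric] sum_mono)
qed

text \<open>Partitions are represented by functions labelling their cells: joins become pairs and
  coarsenings become compositions, so the chain rule and data processing apply. Natural logarithms
  explain the base \<open>exp 1\<close> below.\<close>

definition shannon :: "'a measure \<Rightarrow> ('a \<Rightarrow> 'b) \<Rightarrow> real" where
  "shannon M L = (\<Sum>v\<in>L ` space M.
     - (measure M (L -` {v} \<inter> space M) * ln (measure M (L -` {v} \<inter> space M))))"

context prob_space
begin

lemma information_space_exp: "information_space M (exp 1)"
  by (intro information_space.intro prob_space_axioms information_space_axioms.intro) simp

lemma shannon_eq_entropy:
  assumes "simple_function M L"
  shows "shannon M L = entropy (exp 1) (count_space (L ` space M)) L"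
proof -
  interpret information_space M "exp 1" by (rule information_space_exp)
  show ?thesis
    using entropy_simple_distributed[OF simple_distributedI[OF assms measure_nonneg refl]]
    by (simp add: shannon_def log_def sum_negf)
qed

lemma shannon_Pair_le:
  assumes X: "simple_function M X" and Y: "simple_function M Y"
  shows "shannon M (\<lambda>x. (X x, Y x)) \<le> shannon M X + shannon M Y"
proof -
  interpret information_space M "exp 1" by (rule information_space_exp)
  show ?thesis
    using entropy_chain_rule[OF X Y] conditional_entropy_less_eq_entropy[OF Y X]
    by (simp add: shannon_eq_entropy X Y simple_function_Pair)
qed

lemma shannon_compose_le:
  assumes X: "simple_function M X"
  shows "shannon M (\<lambda>x. f (X x)) \<le> shannon M X"
proof -
  interpret information_space M "exp 1" by (rule information_space_exp)
  show ?thesis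
    using entropy_data_processing[OF X, of f] simple_function_compose[OF X, of f]
    by (simp add: shannon_eq_entropy X comp_def)
qed

lemma shannon_nonneg: "0 \<le> shannon M X"
  unfolding shannon_def
proof (rule sum_nonneg)
  fix v
  show "0 \<le> - (prob (X -` {v} \<inter> space M) * ln (prob (X -` {v} \<inter> space M)))"
    using mult_nonneg_nonpos[of "prob (X -` {v} \<inter> space M)" "ln (prob (X -` {v} \<inter> space M))"]
    by (cases "prob (X -` {v} \<inter> space M) = 0") (auto simp: less_le[of 0])
qed

lemma sum_prob_fibres:
  assumes X: "simple_function M X"
  shows "(\<Sum>v\<in>X ` space M \<inter> A. prob (X -` {v} \<inter> space M)) = prob (X -` A \<inter> space M)"
proof -
  have "(\<Sum>v\<in>X ` space M \<inter> A. prob (X -` {v} \<inter> space M)) =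
      prob (\<Union>v\<in>X ` space M \<inter> A. X -` {v} \<inter> space M)"
    using X by (intro finite_measure_finite_Union[symmetric])
      (auto simp: simple_function_def disjoint_family_on_def)
  also have "(\<Union>v\<in>X ` space M \<inter> A. X -` {v} \<inter> space M) = X -` A \<inter> space M" by auto
  finally show ?thesis .
qed

text \<open>The term of \<open>None\<close> is at most its missing mass, because p ln (1/p) is at
  most 1 - p; every other term is of order \<open>sqrt e\<close>. For fixed \<open>K\<close> the
  bound vanishes with \<open>e\<close>, which is what the Kolmogorov-Sinai argument asks
  for.\<close>

lemma shannon_option_le:
  fixes Z :: "'a \<Rightarrow> 'c option"
  assumes Z: "simple_function M Z" and img: "Z ` space M \<subseteq> insert None (Some ` K)"
    and K: "finite K" and bad: "prob (Z -` (- {None}) \<inter> space M) \<le> e"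
  shows "shannon M Z \<le> e + 2 * real (card K) * sqrt e"
proof -
  let ?p = "\<lambda>v. prob (Z -` {v} \<inter> space M)"
  let ?h = "\<lambda>v. - (?p v * ln (?p v))"
  have e0: "0 \<le> e" using bad measure_nonneg order_trans by blast
  have hnn: "0 \<le> ?h v" for v
    using mult_nonneg_nonpos[of "?p v" "ln (?p v)"]
    by (cases "?p v = 0") (auto simp: less_le[of 0])
  have meas: "Z -` A \<inter> space M \<in> events" for A
    using simple_functionD(2)[OF Z, of A] by simp
  have none: "?h None \<le> e"
  proof (cases "?p None = 0")
    case True then show ?thesis using e0 by simp
  next
    case False
    then have pos: "?p None > 0" by (simp add: less_le)
    have "space M - Z -` {None} \<inter> space M = Z -` (- {None}) \<inter> space M" by auto
    then have "1 - ?p None \<le> e" using prob_compl[OF meas, of "{None}"] bad by simp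
    moreover have "?h None = ?p None * ln (1 / ?p None)" using pos by (simp add: ln_div)
    moreover have "\<dots> \<le> ?p None * (1 / ?p None - 1)"
      using pos by (intro mult_left_mono ln_le_minus_one) auto
    moreover have "\<dots> = 1 - ?p None" using pos by (simp add: field_simps)
    ultimately show ?thesis by linarith
  qed
  have some: "?h (Some c) \<le> 2 * sqrt e" for c
  proof (cases "?p (Some c) = 0")
    case True then show ?thesis using e0 by simp
  next
    case False
    \<comment> \<open>With \<open>p = s * s\<close> the entropy term is
      \<open>2 * s^2 * ln (1 / s)\<close>, and \<open>ln t \<le> t - 1\<close> at
      \<open>t = 1 / s\<close> bounds it by \<open>2 * s\<close>.\<close>
    define s where "s = sqrt (?p (Some c))"
    have s: "s > 0" "?p (Some c) = s * s" using False by (auto simp: s_def less_le)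
    have "?h (Some c) = 2 * s\<^sup>2 * ln (1 / s)"
      using s by (simp add: ln_div ln_mult power2_eq_square)
    also have "\<dots> \<le> 2 * s\<^sup>2 * (1 / s - 1)"
      using s by (intro mult_left_mono ln_le_minus_one) auto
    also have "\<dots> \<le> 2 * s" using s by (simp add: field_simps power2_eq_square)
    also have "s \<le> sqrt e"
    proof -
      have "?p (Some c) \<le> prob (Z -` (- {None}) \<inter> space M)"
        by (intro finite_measure_mono meas) auto
      then show ?thesis unfolding s_def using bad by simp
    qed
    finally show ?thesis by simp
  qed
  have "shannon M Z = (\<Sum>v\<in>Z ` space M. ?h v)" by (simp add: shannon_def)
  also have "\<dots> \<le> (\<Sum>v\<in>insert None (Some ` K). ?h v)"
    using img K hnn by (intro sum_mono2) auto
  also have "\<dots> = ?h None + (\<Sum>c\<in>K. ?h (Some c))"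
    using K by (subst sum.insert) (auto simp: sum.reindex inj_on_def)
  also have "\<dots> \<le> e + (\<Sum>c\<in>K. 2 * sqrt e)" by (intro add_mono none sum_mono some)
  finally show ?thesis by simp
qed

end

section \<open>Words and blocks\<close>

lemma funpow_shift: "(shift ^^ n) x = (\<lambda>i. x (n + i))"
  by (induction n) (auto simp: shift_def)

text \<open>The itinerary of \<open>x\<close> under a labelling \<open>L\<close>. Keeping
  \<open>L\<close> general lets one subadditivity argument cover words, labels of arbitrary
  partitions and the error variable of the Kolmogorov-Sinai theorem.\<close>

definition block :: "((nat \<Rightarrow> 'a) \<Rightarrow> 'b) \<Rightarrow> nat \<Rightarrow> (nat \<Rightarrow> 'a) \<Rightarrow> 'b list" where
  "block L n x = map (\<lambda>i. L ((shift ^^ i) x)) [0..<n]"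

abbreviation word :: "nat \<Rightarrow> (nat \<Rightarrow> 'a) \<Rightarrow> 'a list" where
  "word \<equiv> block (\<lambda>x. x 0)"

lemma length_block [simp]: "length (block L n x) = n"
  by (simp add: block_def)

lemma block_0 [simp]: "block L 0 x = []"
  by (simp add: block_def)

lemma nth_block [simp]: "i < n \<Longrightarrow> block L n x ! i = L ((shift ^^ i) x)"
  by (simp add: block_def)

lemma block_eq_iff: "block L n x = block L' n y \<longleftrightarrow> (\<forall>i<n. L ((shift ^^ i) x) = L' ((shift ^^ i) y))"
  by (auto simp: list_eq_iff_nth_eq)

lemma block_Suc: "block L (Suc n) x = block L n x @ [L ((shift ^^ n) x)]"
  by (simp add: block_def)

lemma block_add: "block L (n + m) x = block L n x @ block L m ((shift ^^ n) x)"
proof (induction m)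
  case (Suc m)
  have "(shift ^^ (n + m)) x = (shift ^^ m) ((shift ^^ n) x)"
    by (simp add: funpow_shift add.assoc)
  with Suc show ?case by (simp add: block_Suc)
qed simp

lemma take_block: "n \<le> m \<Longrightarrow> take n (block L m x) = block L n x"
  by (simp add: list_eq_iff_nth_eq)

lemma word_eq_iff: "word n x = word n y \<longleftrightarrow> (\<forall>i<n. x i = y i)"
  by (simp add: block_eq_iff funpow_shift)

lemma cyl_eq_word: "cyl X n x = {y \<in> X. word n y = word n x}"
  by (simp add: cyl_def word_eq_iff)

lemma subshift_funpow_in:
  assumes "subshift k X" "x \<in> X" shows "(shift ^^ n) x \<in> X"
proof (induction n)
  case (Suc n)
  have "shift ` X \<subseteq> X" using assms(1) by (simp add: subshift_def)
  with Suc show ?case by auto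
qed (simp add: assms)

lemma subshift_letter:
  assumes "subshift k X" "x \<in> X" shows "x i \<in> {1..k}"
  using assms unfolding subshift_def by blast

lemma finite_words:
  assumes "subshift k X" shows "finite (word n ` X)" "card (word n ` X) \<le> k ^ n"
proof -
  have sub: "word n ` X \<subseteq> {w. set w \<subseteq> {1..k} \<and> length w = n}"
  proof (safe, goal_cases)
    case (1 w x v)
    then obtain i where "v = x i" by (auto simp: in_set_conv_nth funpow_shift)
    moreover have "x i \<in> {1..k}" using assms 1 unfolding subshift_def by blast
    ultimately show ?case by simp
  qed simp
  have fin: "finite {w. set w \<subseteq> {1..k} \<and> length w = n}"
    by (rule finite_lists_length_eq) simp
  show "finite (word n ` X)" using finite_subset[OF sub fin] .
  show "card (word n ` X) \<le> k ^ n"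
    using card_mono[OF fin sub] by (simp add: card_lists_length_eq)
qed

text \<open>For a countable product the Borel sets of the product topology are those of the product
  sigma-algebra, and every subset of the discrete space \<open>nat\<close> is Borel.\<close>

lemma borel_measurable_coordinate:
  "(\<lambda>x::nat \<Rightarrow> nat. x i) \<in> measurable (restrict_space borel X) (count_space (UNIV :: nat set))"
proof -
  have "(\<lambda>x::nat \<Rightarrow> nat. x i) \<in> measurable (PiM UNIV (\<lambda>_. borel)) borel"
    by (rule measurable_component_singleton) simp
  moreover have "measurable (PiM UNIV (\<lambda>_. borel)) borel =
      measurable (borel :: (nat \<Rightarrow> nat) measure) (borel :: nat measure)"
    by (rule measurable_cong_sets[OF sets_PiM_equal_borel refl])
  moreover have "measurable (borel :: (nat \<Rightarrow> nat) measure) (borel :: nat measure) =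
      measurable borel (count_space UNIV)"
    by (rule measurable_cong_sets) (simp_all add: sets_borel_eq_count_space)
  ultimately show ?thesis by (auto intro: measurable_restrict_space1)
qed

lemma measurable_seqI:
  fixes f :: "'a \<Rightarrow> nat \<Rightarrow> nat"
  assumes "\<And>i. (\<lambda>x. f x i) \<in> measurable M (count_space UNIV)" "f \<in> space M \<rightarrow> X"
  shows "f \<in> measurable M (restrict_space borel X)"
proof (intro measurable_restrict_space2 assms(2) measurable_coordinatewise_then_product)
  fix i
  have "measurable M (borel :: nat measure) = measurable M (count_space UNIV)"
    by (rule measurable_cong_sets) (simp_all add: sets_borel_eq_count_space)
  then show "(\<lambda>x. f x i) \<in> borel_measurable M" using assms(1) by simp
qed

text \<open>For a subshift these are the finite unions of cylinders, an algebra generating the Borel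
  sets. \<open>W\<close> may be any set of lists, so a complement in X just complements
  \<open>W\<close>.\<close>

definition word_set :: "(nat \<Rightarrow> nat) set \<Rightarrow> (nat \<Rightarrow> nat) set \<Rightarrow> bool" where
  "word_set X S \<longleftrightarrow> (\<exists>n W. S = {x \<in> X. word n x \<in> W})"

lemma word_set_extend:
  assumes "n \<le> m" shows "{x \<in> X. word n x \<in> W} = {x \<in> X. word m x \<in> take n -` W}"
  using assms by (auto simp: take_block)

lemma word_set_common:
  assumes "finite I" "\<And>i. i \<in> I \<Longrightarrow> word_set X (S i)"
  obtains n W where "\<forall>i\<in>I. S i = {x \<in> X. word n x \<in> W i}"
proof -
  have "\<forall>i\<in>I. \<exists>p. S i = {x \<in> X. word (fst p) x \<in> snd p}"
    using assms(2) unfolding word_set_def by simp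
  then obtain p where p: "\<forall>i\<in>I. S i = {x \<in> X. word (fst (p i)) x \<in> snd (p i)}"
    by (rule bchoice[THEN exE])
  define N V where "N i = fst (p i)" and "V i = snd (p i)" for i
  have NV: "S i = {x \<in> X. word (N i) x \<in> V i}" if "i \<in> I" for i
    using p that by (simp add: N_def V_def)
  \<comment> \<open>Any common upper bound of the lengths serves; the sum also covers an empty
    \<open>I\<close>.\<close>
  define n where "n = (\<Sum>i\<in>I. N i)"
  have "S i = {x \<in> X. word n x \<in> take (N i) -` V i}" if "i \<in> I" for i
    unfolding NV[OF that] using assms(1) that
    by (intro word_set_extend) (auto simp: n_def intro: member_le_sum)
  then show thesis using that[of n "\<lambda>i. take (N i) -` V i"] by blast
qed

lemma word_set_UN:
  assumes "finite I" "\<And>i. i \<in> I \<Longrightarrow> word_set X (S i)"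
  shows "word_set X (\<Union>i\<in>I. S i)"
proof -
  obtain n W where nW: "\<forall>i\<in>I. S i = {x \<in> X. word n x \<in> W i}"
    by (rule word_set_common[OF assms])
  then have "(\<Union>i\<in>I. S i) = {x \<in> X. word n x \<in> (\<Union>i\<in>I. W i)}" by auto
  then show ?thesis unfolding word_set_def by blast
qed

lemma word_set_Diff: "word_set X S \<Longrightarrow> word_set X (X - S)"
proof -
  assume "word_set X S"
  then obtain n W where "S = {x \<in> X. word n x \<in> W}" by (auto simp: word_set_def)
  then have "X - S = {x \<in> X. word n x \<in> - W}" by auto
  then show ?thesis unfolding word_set_def by blast
qed

lemma simple_function_blockI:
  assumes "\<And>i. simple_function M (\<lambda>x. L ((shift ^^ i) x))"
  shows "simple_function M (block L n)"
proof (induction n)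
  case 0
  have "block L 0 = (\<lambda>_. [])" by (simp add: fun_eq_iff)
  then show ?case by simp
next
  case (Suc n)
  have "block L (Suc n) = (\<lambda>x. block L n x @ [L ((shift ^^ n) x)])"
    by (simp add: fun_eq_iff block_Suc)
  then show ?case using simple_function_compose2[OF Suc assms[of n], of "\<lambda>xs v. xs @ [v]"] by simp
qed

lemma simple_function_word:
  assumes X: "subshift k X" and M: "sets M = sets (restrict_space borel X)"
  shows "simple_function M (word n)"
proof (rule simple_function_blockI)
  fix i
  have sp: "space M = X" using sets_eq_imp_space_eq[OF M] by (simp add: space_restrict_space)
  have "(\<lambda>x. x i) ` X \<subseteq> {1..k}" using subshift_letter[OF X] by (intro image_subsetI)
  then have fin: "finite ((\<lambda>x. x i) ` X)" by (rule finite_subset) simp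
  have meas: "(\<lambda>x. x i) -` {v} \<inter> space M \<in> sets M" for v
    using measurable_sets[OF borel_measurable_coordinate[of i X], of "{v}"]
    unfolding M sp space_restrict_space by simp
  show "simple_function M (\<lambda>x. (shift ^^ i) x 0)"
    unfolding simple_function_def funpow_shift using fin meas by (simp add: sp)
qed

lemma word_set_sets:
  assumes "subshift k X" "sets M = sets (restrict_space borel X)" "word_set X S"
  shows "S \<in> sets M"
proof -
  have sp: "space M = X"
    using sets_eq_imp_space_eq[OF assms(2)] by (simp add: space_restrict_space)
  obtain n W where "S = {x \<in> X. word n x \<in> W}" using assms(3) by (auto simp: word_set_def)
  then have "S = word n -` W \<inter> space M" using sp by auto
  then show ?thesis
    using simple_functionD(2)[OF simple_function_word[OF assms(1,2), of n], of W] by simp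
qed

text \<open>Approximable sets include the coordinate sets and are closed under complements and
  countable unions, hence comprise all Borel sets. One \<open>S\<close> has to serve both measures:
  in the proof of absolute continuity it carries an estimate from \<open>\<nu>\<close> over to
  N.\<close>

lemma word_set_approximation:
  fixes P Q :: "(nat \<Rightarrow> nat) measure"
  assumes X: "subshift k X" and fin: "finite_measure P" "finite_measure Q"
    and sP: "sets P = sets (restrict_space borel X)" and sQ: "sets Q = sets (restrict_space borel X)"
    and A: "A \<in> sets P" and e: "e > 0"
  obtains S where "word_set X S" "measure P (A - S \<union> (S - A)) \<le> e" "measure Q (A - S \<union> (S - A)) \<le> e"
proof -
  interpret P: finite_measure P by fact
  interpret Q: finite_measure Q by fact
  have PQ: "sets Q = sets P" using sP sQ by simp
  have sp: "space P = X" "space Q = X"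
    using sets_eq_imp_space_eq[OF sP] sets_eq_imp_space_eq[OF sQ]
    by (simp_all add: space_restrict_space)
  note wsP = word_set_sets[OF X sP]
  define good where "good A \<longleftrightarrow> (\<forall>e>0. \<exists>S. word_set X S \<and>
      measure P (A - S \<union> (S - A)) \<le> e \<and> measure Q (A - S \<union> (S - A)) \<le> e)" for A
  have sborel: "sets (borel :: (nat \<Rightarrow> nat) measure) =
      sigma_sets UNIV {{f. f i \<in> A} | (i :: nat) (A :: nat set). True}"
    unfolding sets_PiM_equal_borel[symmetric] sets_PiM_single
    by (simp add: sets_borel_eq_count_space)
  have into: "B \<inter> X \<in> sets P" if "B \<in> sets borel" for B
    unfolding sP sets_restrict_space using that by auto
  have "good (B \<inter> X)" if "B \<in> sigma_sets UNIV {{f. f i \<in> A} | (i :: nat) (A :: nat set). True}" for B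
    using that
  proof induction
    case (Basic B)
    then obtain i A where B: "B = {f. f i \<in> A}" by auto
    have "B \<inter> X = {x \<in> X. word (Suc i) x \<in> {w. w ! i \<in> A}}"
      by (auto simp: B funpow_shift)
    then have "word_set X (B \<inter> X)" unfolding word_set_def by blast
    moreover have "B \<inter> X - B \<inter> X \<union> (B \<inter> X - B \<inter> X) = {}" by simp
    ultimately show ?case unfolding good_def by (metis measure_empty less_imp_le)
  next
    case Empty
    have "word_set X {}" unfolding word_set_def by (rule exI[of _ 0], rule exI[of _ "{}"]) simp
    moreover have "{} \<inter> X - {} \<union> ({} - {} \<inter> X) = {}" by simp
    ultimately show ?case unfolding good_def by (metis measure_empty less_imp_le)
  next
    case (Compl B)
    show ?case unfolding good_def
    proof (intro allI impI)
      fix e :: real assume "e > 0"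
      then obtain S where S: "word_set X S" "measure P (B \<inter> X - S \<union> (S - B \<inter> X)) \<le> e"
          "measure Q (B \<inter> X - S \<union> (S - B \<inter> X)) \<le> e"
        using Compl.IH unfolding good_def by blast
      have "S \<subseteq> X" using S(1) by (auto simp: word_set_def)
      then have "(UNIV - B) \<inter> X - (X - S) \<union> (X - S - (UNIV - B) \<inter> X) =
          B \<inter> X - S \<union> (S - B \<inter> X)" by auto
      then show "\<exists>S. word_set X S \<and>
          measure P ((UNIV - B) \<inter> X - S \<union> (S - (UNIV - B) \<inter> X)) \<le> e \<and>
          measure Q ((UNIV - B) \<inter> X - S \<union> (S - (UNIV - B) \<inter> X)) \<le> e"
        using S word_set_Diff[OF S(1)] by (intro exI[of _ "X - S"]) simp
    qed
  next
    case (Union B)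
    show ?case unfolding good_def
    proof (intro allI impI)
      fix e :: real assume e: "e > 0"
      define U where "U N = (\<Union>i<N. B i \<inter> X)" for N
      have BP: "B i \<inter> X \<in> sets P" for i
        using Union(1) by (intro into) (simp add: sborel)
      then have UP: "U N \<in> sets P" for N unfolding U_def by (intro sets.finite_UN) auto
      have inc: "incseq U" unfolding U_def by (intro monoI UN_mono) auto
      have UU: "(\<Union>N. U N) = (\<Union>i. B i) \<inter> X" unfolding U_def by auto
      have "(\<lambda>N. measure P (U N)) \<longlonglongrightarrow> measure P ((\<Union>i. B i) \<inter> X)"
        using P.finite_Lim_measure_incseq[of U] UP inc by (auto simp: UU image_subset_iff)
      then have "eventually (\<lambda>N. measure P ((\<Union>i. B i) \<inter> X) - e / 2 < measure P (U N)) sequentially"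
        using e by (intro order_tendstoD(1)) auto
      moreover have "(\<lambda>N. measure Q (U N)) \<longlonglongrightarrow> measure Q ((\<Union>i. B i) \<inter> X)"
        using Q.finite_Lim_measure_incseq[of U] UP inc by (auto simp: UU image_subset_iff PQ)
      then have "eventually (\<lambda>N. measure Q ((\<Union>i. B i) \<inter> X) - e / 2 < measure Q (U N)) sequentially"
        using e by (intro order_tendstoD(1)) auto
      ultimately have "eventually (\<lambda>N. measure P ((\<Union>i. B i) \<inter> X) - e / 2 < measure P (U N) \<and>
          measure Q ((\<Union>i. B i) \<inter> X) - e / 2 < measure Q (U N)) sequentially"
        by (rule eventually_conj)
      then obtain N where N: "measure P ((\<Union>i. B i) \<inter> X) - e / 2 < measure P (U N)"
          "measure Q ((\<Union>i. B i) \<inter> X) - e / 2 < measure Q (U N)"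
        using eventually_happens'[OF sequentially_bot] by blast
      \<comment> \<open>Half of \<open>e\<close> pays for truncating the union at \<open>N\<close>,
        chosen for both measures at once; the other half is shared by \<open>N\<close>
        approximations. The added 1 covers \<open>N = 0\<close>.\<close>
      define d where "d = e / (2 * (real N + 1))"
      have d: "d > 0" "real N * d \<le> e / 2"
        using e by (auto simp: d_def field_simps)
      have "\<forall>i. \<exists>S. word_set X S \<and> measure P (B i \<inter> X - S \<union> (S - B i \<inter> X)) \<le> d \<and>
           measure Q (B i \<inter> X - S \<union> (S - B i \<inter> X)) \<le> d"
        using Union.IH d unfolding good_def by blast
      then obtain S where S: "\<And>i. word_set X (S i)"
          "\<And>i. measure P (B i \<inter> X - S i \<union> (S i - B i \<inter> X)) \<le> d"
          "\<And>i. measure Q (B i \<inter> X - S i \<union> (S i - B i \<inter> X)) \<le> d"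
        by metis
      define T where "T = (\<Union>i<N. S i)"
      have T: "word_set X T" unfolding T_def by (intro word_set_UN S) auto
      define D where "D i = B i \<inter> X - S i \<union> (S i - B i \<inter> X)" for i
      have DP: "D i \<in> sets P" for i unfolding D_def using BP wsP[OF S(1)] by auto
      let ?E = "(\<Union>i. B i) \<inter> X - T \<union> (T - (\<Union>i. B i) \<inter> X)"
      let ?R = "(\<Union>i. B i) \<inter> X - U N"
      have allP: "(\<Union>i. B i) \<inter> X \<in> sets P" unfolding UU[symmetric] using UP by auto
      have sub: "?E \<subseteq> ?R \<union> (\<Union>i<N. D i)" unfolding U_def T_def D_def by auto
      have UN: "U N \<subseteq> (\<Union>i. B i) \<inter> X" unfolding U_def by auto
      have "measure P ?E \<le> measure P (?R \<union> (\<Union>i<N. D i))"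
        using allP UP DP by (intro P.finite_measure_mono sub) auto
      also have "\<dots> \<le> measure P ?R + measure P (\<Union>i<N. D i)"
        using allP UP DP by (intro measure_Un_le) auto
      also have "measure P (\<Union>i<N. D i) \<le> (\<Sum>i<N. measure P (D i))"
        using DP by (intro P.finite_measure_subadditive_finite) auto
      also have "\<dots> \<le> (\<Sum>i<N. d)" using S(2) by (intro sum_mono) (simp add: D_def)
      also have "measure P ?R = measure P ((\<Union>i. B i) \<inter> X) - measure P (U N)"
        using allP UP UN by (intro P.finite_measure_Diff) auto
      finally have 1: "measure P ?E \<le> e" using N d by simp
      have "measure Q ?E \<le> measure Q (?R \<union> (\<Union>i<N. D i))"
        using allP UP DP by (intro Q.finite_measure_mono sub) (auto simp: PQ)
      also have "\<dots> \<le> measure Q ?R + measure Q (\<Union>i<N. D i)"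
        using allP UP DP by (intro measure_Un_le) (auto simp: PQ)
      also have "measure Q (\<Union>i<N. D i) \<le> (\<Sum>i<N. measure Q (D i))"
        using DP by (intro Q.finite_measure_subadditive_finite) (auto simp: PQ)
      also have "\<dots> \<le> (\<Sum>i<N. d)" using S(3) by (intro sum_mono) (simp add: D_def)
      also have "measure Q ?R = measure Q ((\<Union>i. B i) \<inter> X) - measure Q (U N)"
        using allP UP UN by (intro Q.finite_measure_Diff) (auto simp: PQ)
      finally have 2: "measure Q ?E \<le> e" using N d by simp
      have "(\<Union> (range B)) = (\<Union>i. B i)" by simp
      then show "\<exists>S. word_set X S \<and> measure P (\<Union> (range B) \<inter> X - S \<union> (S - \<Union> (range B) \<inter> X)) \<le> e \<and>
          measure Q (\<Union> (range B) \<inter> X - S \<union> (S - \<Union> (range B) \<inter> X)) \<le> e"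
        using T 1 2 by blast
    qed
  qed
  moreover obtain B where "B \<in> sets borel" "A = B \<inter> X"
    using A unfolding sP sets_restrict_space by auto
  ultimately have "good A" by (simp add: sborel)
  then show thesis using that e unfolding good_def by blast
qed

section \<open>Invariant measures and the Kolmogorov--Sinai theorem\<close>

locale invariant_subshift =
  fixes k :: nat and X :: "(nat \<Rightarrow> nat) set" and M :: "(nat \<Rightarrow> nat) measure"
  assumes subshift: "subshift k X" and invariant: "invariant_measure X M"
begin

sublocale prob_space M
  using invariant by (simp add: invariant_measure_def prob_on_def)

lemma sets_M: "sets M = sets (restrict_space borel X)"
  using invariant by (simp add: invariant_measure_def prob_on_def)

lemma space_M: "space M = X"
  using sets_eq_imp_space_eq[OF sets_M] by (simp add: space_restrict_space)

lemma X_events: "X \<in> events"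
  using sets.top[of M] by (simp add: space_M)

lemma shift_in: "x \<in> X \<Longrightarrow> shift x \<in> X"
  using subshift by (auto simp: subshift_def)

lemma funpow_in: "x \<in> X \<Longrightarrow> (shift ^^ n) x \<in> X"
  by (rule subshift_funpow_in[OF subshift])

lemma simple_function_words: "simple_function M (word n)"
  by (rule simple_function_word[OF subshift sets_M])

lemma simple_function_first: "simple_function M (\<lambda>x. x 0)"
proof -
  have "(\<lambda>x. x 0) = (\<lambda>x :: nat \<Rightarrow> nat. hd (word 1 x))" by (simp add: fun_eq_iff block_def)
  then show ?thesis using simple_function_compose1[OF simple_function_words[of 1], of hd] by metis
qed

lemma shift_measurable: "shift \<in> measurable M M"
proof -
  have "shift \<in> measurable M (restrict_space borel X)"
  proof (rule measurable_seqI)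
    show "shift \<in> space M \<rightarrow> X" by (auto simp: space_M shift_in)
    fix i
    have "measurable M (count_space UNIV) = measurable (restrict_space borel X) (count_space (UNIV :: nat set))"
      by (rule measurable_cong_sets[OF sets_M refl])
    then show "(\<lambda>x. shift x i) \<in> measurable M (count_space UNIV)"
      using borel_measurable_coordinate[of "Suc i" X] by (simp add: shift_def)
  qed
  then show ?thesis using measurable_cong_sets[OF refl sets_M] by blast
qed

lemma shift_preimage:
  assumes "A \<in> events"
  shows "{x \<in> X. (shift ^^ n) x \<in> A} \<in> events \<and> prob {x \<in> X. (shift ^^ n) x \<in> A} = prob A"
proof (induction n)
  case 0
  have "{x \<in> X. x \<in> A} = A" using sets.sets_into_space[OF assms] by (auto simp: space_M)
  then show ?case using assms by simp
next
  case (Suc n)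
  let ?B = "{x \<in> X. (shift ^^ n) x \<in> A}"
  have eq: "{x \<in> X. (shift ^^ Suc n) x \<in> A} = shift -` ?B \<inter> X"
    using shift_in by (auto simp: funpow_Suc_right simp del: funpow.simps)
  have "shift -` ?B \<inter> X \<in> events"
    using measurable_sets[OF shift_measurable, of ?B] Suc by (simp add: space_M)
  moreover have "prob (shift -` ?B \<inter> X) = prob ?B"
  proof -
    have "\<forall>A\<in>events. emeasure M (shift -` A \<inter> X) = emeasure M A"
      using invariant by (simp add: invariant_measure_def)
    then have "emeasure M (shift -` ?B \<inter> X) = emeasure M ?B" using Suc by blast
    then show ?thesis by (simp only: measure_def)
  qed
  ultimately show ?case unfolding eq using Suc by simp
qed

lemma simple_function_shift:
  assumes "simple_function M L"
  shows "simple_function M (\<lambda>x. L ((shift ^^ n) x))"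
proof -
  have "(\<lambda>x. L ((shift ^^ n) x)) ` X \<subseteq> L ` X" using funpow_in by auto
  moreover have "finite (L ` X)" using assms by (simp add: simple_function_def space_M)
  ultimately have "finite ((\<lambda>x. L ((shift ^^ n) x)) ` X)" by (rule finite_subset)
  moreover have "(\<lambda>x. L ((shift ^^ n) x)) -` {v} \<inter> X \<in> events" for v
  proof -
    have "(\<lambda>x. L ((shift ^^ n) x)) -` {v} \<inter> X = {x \<in> X. (shift ^^ n) x \<in> L -` {v} \<inter> space M}"
      using funpow_in by (auto simp: space_M)
    then show ?thesis
      using shift_preimage[OF simple_functionD(2)[OF assms, of "{v}"], THEN conjunct1] by (simp only:)
  qed
  ultimately show ?thesis by (simp add: simple_function_def space_M)
qed

lemma prob_shift_fibre:
  assumes "simple_function M L"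
  shows "prob ((\<lambda>x. L ((shift ^^ n) x)) -` {v} \<inter> space M) = prob (L -` {v} \<inter> space M)"
proof -
  have "(\<lambda>x. L ((shift ^^ n) x)) -` {v} \<inter> space M = {x \<in> X. (shift ^^ n) x \<in> L -` {v} \<inter> space M}"
    using funpow_in by (auto simp: space_M)
  then show ?thesis
    using shift_preimage[OF simple_functionD(2)[OF assms, of "{v}"], THEN conjunct2] by (simp only:)
qed

lemma shannon_shift:
  assumes "simple_function M L"
  shows "shannon M (\<lambda>x. L ((shift ^^ n) x)) = shannon M L"
proof -
  let ?S = "\<lambda>x. L ((shift ^^ n) x)"
  note eq = prob_shift_fibre[OF assms]
  have sub: "?S ` space M \<subseteq> L ` space M" unfolding space_M using funpow_in by blast
  \<comment> \<open>The shift need not map X onto X, so some values of \<open>L\<close> may be lost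
    after shifting; by invariance they have mass zero.\<close>
  have "prob (L -` {v} \<inter> space M) = 0" if "v \<in> L ` space M - ?S ` space M" for v
  proof -
    have "?S -` {v} \<inter> space M = {}" using that by blast
    then show ?thesis using eq[of n v] by simp
  qed
  then show ?thesis
    unfolding shannon_def eq using sub assms
    by (intro sum.mono_neutral_left) (auto simp: simple_function_def)
qed

lemma simple_function_block:
  "simple_function M L \<Longrightarrow> simple_function M (block L n)"
  by (intro simple_function_blockI simple_function_shift)

lemma shannon_block_add:
  assumes L: "simple_function M L"
  shows "shannon M (block L (n + m)) \<le> shannon M (block L n) + shannon M (block L m)"
proof -
  note B = simple_function_block[OF L]
  have "block L (n + m) = (\<lambda>x. (\<lambda>(u, v). u @ v) (block L n x, block L m ((shift ^^ n) x)))"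
    by (simp add: fun_eq_iff block_add)
  then have "shannon M (block L (n + m)) \<le> shannon M (\<lambda>x. (block L n x, block L m ((shift ^^ n) x)))"
    using shannon_compose_le[OF simple_function_Pair[OF B[of n] simple_function_shift[OF B[of m], of n]],
        of "\<lambda>(u, v). u @ v"] by (simp only:)
  also have "\<dots> \<le> shannon M (block L n) + shannon M (block L m)"
    using shannon_Pair_le[OF B[of n] simple_function_shift[OF B[of m], of n]] shannon_shift[OF B[of m]]
    by simp
  finally show ?thesis .
qed

lemma shannon_block_le:
  assumes L: "simple_function M L"
  shows "shannon M (block L n) \<le> real n * shannon M L"
proof (induction n)
  case 0
  have "block L 0 ` space M = {[]}" using not_empty by auto
  moreover have "block L 0 -` {[]} \<inter> space M = space M" by auto
  ultimately show ?case by (simp add: shannon_def prob_space)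
next
  case (Suc n)
  have "block L (Suc 0) = (\<lambda>x. [L x])" by (simp add: fun_eq_iff block_def)
  then have "shannon M (block L (Suc 0)) \<le> shannon M L"
    using shannon_compose_le[OF L, of "\<lambda>v. [v]"] by (simp only:)
  moreover have "shannon M (block L (Suc n)) \<le> shannon M (block L n) + shannon M (block L (Suc 0))"
    using shannon_block_add[OF L, of n "Suc 0"] by (simp only: add_Suc_right add_0_right)
  moreover have "real (Suc n) * shannon M L = real n * shannon M L + shannon M L"
    by (simp add: algebra_simps)
  ultimately show ?case using Suc by linarith
qed

section \<open>Entropy rates of itineraries\<close>

definition rate :: "((nat \<Rightarrow> nat) \<Rightarrow> 'b) \<Rightarrow> real" where
  "rate L = lim (\<lambda>n. shannon M (block L n) / real n)"

lemma rate_exists: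
  assumes L: "simple_function M L"
  obtains h where "(\<lambda>n. shannon M (block L n) / real n) \<longlonglongrightarrow> h"
    "\<And>n. n \<ge> 1 \<Longrightarrow> real n * h \<le> shannon M (block L n)"
  by (rule fekete_subadditive[of "\<lambda>n. shannon M (block L n)" 0])
    (use shannon_block_add[OF L] shannon_nonneg in auto)

lemma rate_LIMSEQ:
  assumes "simple_function M L"
  shows "(\<lambda>n. shannon M (block L n) / real n) \<longlonglongrightarrow> rate L"
proof -
  obtain h where "(\<lambda>n. shannon M (block L n) / real n) \<longlonglongrightarrow> h"
    using rate_exists[OF assms] by blast
  then show ?thesis unfolding rate_def using limI by metis
qed

text \<open>Fekete's limit is an infimum, so the rate bounds the block entropy at each
  \<open>n\<close> without any error term. The uniqueness of equilibrium states rests on this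
  form.\<close>

lemma rate_le:
  assumes L: "simple_function M L" and n: "n \<ge> 1"
  shows "real n * rate L \<le> shannon M (block L n)"
proof -
  obtain h where h: "(\<lambda>n. shannon M (block L n) / real n) \<longlonglongrightarrow> h"
    "\<And>n. n \<ge> 1 \<Longrightarrow> real n * h \<le> shannon M (block L n)"
    using rate_exists[OF L] by blast
  have "h = rate L" by (rule LIMSEQ_unique[OF h(1) rate_LIMSEQ[OF L]])
  then show ?thesis using h(2)[OF n] by simp
qed

lemma rate_compose_le:
  assumes L: "simple_function M L"
  shows "rate (\<lambda>x. f (L x)) \<le> rate L"
proof -
  have fL: "simple_function M (\<lambda>x. f (L x))"
    by (rule simple_function_compose1[OF L])
  have "shannon M (block (\<lambda>x. f (L x)) n) \<le> shannon M (block L n)" for n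
  proof -
    have "block (\<lambda>x. f (L x)) n = (\<lambda>x. map f (block L n x))" by (simp add: fun_eq_iff block_def)
    then show ?thesis using shannon_compose_le[OF simple_function_block[OF L], of "map f"] by (simp only:)
  qed
  then show ?thesis
    by (intro LIMSEQ_le[OF rate_LIMSEQ[OF fL] rate_LIMSEQ[OF L]]) (auto intro!: divide_right_mono)
qed

section \<open>Partitions and the Kolmogorov-Sinai theorem\<close>

definition label :: "(nat \<Rightarrow> nat) set set \<Rightarrow> (nat \<Rightarrow> nat) \<Rightarrow> (nat \<Rightarrow> nat) set" where
  "label \<xi> x = (THE C. C \<in> \<xi> \<and> x \<in> C)"

lemma label_eqI:
  assumes "meas_partition X M \<xi>" "C \<in> \<xi>" "x \<in> C" shows "label \<xi> x = C"
  unfolding label_def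
  using assms by (intro the_equality) (auto simp: meas_partition_def disjoint_def)

lemma label_in:
  assumes "meas_partition X M \<xi>" "x \<in> X" shows "label \<xi> x \<in> \<xi>" "x \<in> label \<xi> x"
proof -
  obtain C where "C \<in> \<xi>" "x \<in> C" using assms by (auto simp: meas_partition_def)
  then show "label \<xi> x \<in> \<xi>" "x \<in> label \<xi> x" using label_eqI[OF assms(1)] by auto
qed

lemma label_simple:
  assumes "meas_partition X M \<xi>" shows "simple_function M (label \<xi>)"
proof -
  have sub: "label \<xi> ` X \<subseteq> \<xi>" using label_in(1)[OF assms] by (intro image_subsetI)
  have "label \<xi> -` {C} \<inter> X \<in> events" if "C \<in> label \<xi> ` X" for C
  proof -
    have "C \<in> \<xi>" using that sub by blast
    moreover have "C \<in> events" using assms \<open>C \<in> \<xi>\<close> by (auto simp: meas_partition_def)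
    moreover have "C \<subseteq> X" using sets.sets_into_space[OF \<open>C \<in> events\<close>] by (simp add: space_M)
    ultimately have "label \<xi> -` {C} \<inter> X = C"
      using label_eqI[OF assms] label_in(2)[OF assms] by blast
    then show ?thesis using \<open>C \<in> events\<close> by simp
  qed
  moreover have "finite (label \<xi> ` X)"
    using sub assms by (simp add: meas_partition_def finite_subset)
  ultimately show ?thesis by (simp add: simple_function_def space_M)
qed

text \<open>Nonempty members of the join correspond bijectively to the label blocks that occur.
  Incompatible choices of cells put the empty set into \<open>join_part\<close>; it contributes
  nothing because its term is \<open>0 * ln 0\<close>.\<close>

lemma part_entropy_join:
  assumes \<xi>: "meas_partition X M \<xi>"
  shows "part_entropy M (join_part X \<xi> n) = shannon M (block (label \<xi>) n)"
proof -
  let ?B = "block (label \<xi>) n"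
  let ?\<phi> = "\<lambda>v. ?B -` {v} \<inter> space M"
  have finB: "finite (?B ` X)"
    using simple_function_block[OF label_simple[OF \<xi>], of n] by (simp add: simple_function_def space_M)
  have cell: "(\<Inter>i<n. (shift ^^ i) -` A i) \<inter> X = ?\<phi> (?B x)"
    if A: "\<forall>i<n. A i \<in> \<xi>" and x: "x \<in> (\<Inter>i<n. (shift ^^ i) -` A i) \<inter> X" for A x
  proof -
    have lab: "(shift ^^ i) y \<in> A i \<longleftrightarrow> label \<xi> ((shift ^^ i) y) = A i" if "i < n" "y \<in> X" for i y
      using that A label_eqI[OF \<xi>] label_in[OF \<xi> funpow_in[OF that(2)]] by metis
    have "label \<xi> ((shift ^^ i) x) = A i" if "i < n" for i using lab that x by auto
    then show ?thesis using lab by (auto simp: space_M block_eq_iff)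
  qed
  have img: "join_part X \<xi> n - {{}} = ?\<phi> ` (?B ` X)"
  proof (intro equalityI subsetI)
    fix D assume "D \<in> join_part X \<xi> n - {{}}"
    then obtain A where A: "D = (\<Inter>i<n. (shift ^^ i) -` A i) \<inter> X" "\<forall>i<n. A i \<in> \<xi>" "D \<noteq> {}"
      by (auto simp: join_part_def)
    then obtain x where "x \<in> D" by blast
    then show "D \<in> ?\<phi> ` (?B ` X)" using cell[OF A(2)] A(1) by blast
  next
    fix D assume "D \<in> ?\<phi> ` (?B ` X)"
    then obtain x where x: "x \<in> X" "D = ?\<phi> (?B x)" by blast
    define A where "A i = label \<xi> ((shift ^^ i) x)" for i
    have A: "\<forall>i<n. A i \<in> \<xi>" "x \<in> (\<Inter>i<n. (shift ^^ i) -` A i) \<inter> X"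
      using x label_in[OF \<xi> funpow_in[OF x(1)]] by (auto simp: A_def)
    have "D = (\<Inter>i<n. (shift ^^ i) -` A i) \<inter> X" using cell[OF A] x by simp
    moreover have "D \<noteq> {}" using A(2) calculation by blast
    ultimately show "D \<in> join_part X \<xi> n - {{}}" unfolding join_part_def using A(1) by blast
  qed
  have inj: "inj_on ?\<phi> (?B ` X)"
  proof (rule inj_onI)
    fix v w assume v: "v \<in> ?B ` X" and eq: "?\<phi> v = ?\<phi> w"
    then obtain x where "x \<in> ?\<phi> v" by (auto simp: space_M)
    then show "v = w" using eq by auto
  qed
  have finJ: "finite (join_part X \<xi> n)"
  proof -
    have "finite (join_part X \<xi> n - {{}})" unfolding img using finB by simp
    then show ?thesis by simp
  qed
  have "part_entropy M (join_part X \<xi> n) = (\<Sum>C\<in>join_part X \<xi> n - {{}}. - (prob C * ln (prob C)))"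
    unfolding part_entropy_def using finJ by (intro sum.mono_neutral_right) auto
  also have "\<dots> = shannon M ?B"
    unfolding img using inj by (simp add: sum.reindex shannon_def space_M)
  finally show ?thesis .
qed

lemma entropy_rate_eq: "meas_partition X M \<xi> \<Longrightarrow> entropy_rate X M \<xi> = rate (label \<xi>)"
  by (simp add: entropy_rate_def rate_def part_entropy_join)

text \<open>Each cell is replaced by a word set, all of one length \<open>m\<close>. Off the
  finitely many symmetric differences exactly one of these word sets contains a given point, namely
  the one belonging to its cell.\<close>

lemma prob_label_approximation:
  assumes \<xi>: "meas_partition X M \<xi>" and e: "e > 0"
  obtains m \<eta> where "prob {x \<in> X. label \<xi> x \<noteq> \<eta> (word m x)} \<le> e"
proof -
  define d where "d = e / (real (card \<xi>) + 1)"
  have d: "d > 0" "real (card \<xi>) * d \<le> e" using e by (auto simp: d_def field_simps)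
  have fin: "finite \<xi>" and ev: "\<And>C. C \<in> \<xi> \<Longrightarrow> C \<in> events" using \<xi> by (auto simp: meas_partition_def)
  have "\<exists>S. word_set X S \<and> prob (C - S \<union> (S - C)) \<le> d" if "C \<in> \<xi>" for C
    using word_set_approximation[OF subshift _ _ sets_M sets_M ev[OF that] d(1)]
      finite_measure_axioms by metis
  then have "\<forall>C\<in>\<xi>. \<exists>S. word_set X S \<and> prob (C - S \<union> (S - C)) \<le> d" by blast
  then obtain S where S: "\<forall>C\<in>\<xi>. word_set X (S C) \<and> prob (C - S C \<union> (S C - C)) \<le> d"
    by (rule bchoice[THEN exE])
  have "\<And>C. C \<in> \<xi> \<Longrightarrow> word_set X (S C)" using S by blast
  then obtain m W where W: "\<forall>C\<in>\<xi>. S C = {x \<in> X. word m x \<in> W C}"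
    by (rule word_set_common[OF fin])
  \<comment> \<open>The replaced cells may overlap or leave gaps, where the choice is arbitrary; the
    points concerned lie in some \<open>D C\<close>.\<close>
  define \<eta> where "\<eta> w = (SOME C. C \<in> \<xi> \<and> w \<in> W C)" for w
  define D where "D C = C - S C \<union> (S C - C)" for C
  have SE: "S C \<in> events" if "C \<in> \<xi>" for C
    using S that word_set_sets[OF subshift sets_M] by blast
  have DE: "D C \<in> events" if "C \<in> \<xi>" for C unfolding D_def using SE[OF that] ev[OF that] by auto
  have sub: "{x \<in> X. label \<xi> x \<noteq> \<eta> (word m x)} \<subseteq> (\<Union>C\<in>\<xi>. D C)"
  proof (rule subsetI, rule ccontr)
    fix x assume x: "x \<in> {x \<in> X. label \<xi> x \<noteq> \<eta> (word m x)}" and n: "x \<notin> (\<Union>C\<in>\<xi>. D C)"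
    have xX: "x \<in> X" using x by simp
    have iff: "word m x \<in> W C \<longleftrightarrow> x \<in> C" if "C \<in> \<xi>" for C
      using n that W xX by (auto simp: D_def)
    have "\<eta> (word m x) = label \<xi> x"
      unfolding \<eta>_def
    proof (rule some_equality)
      show "label \<xi> x \<in> \<xi> \<and> word m x \<in> W (label \<xi> x)" using label_in[OF \<xi> xX] iff by blast
      show "C = label \<xi> x" if "C \<in> \<xi> \<and> word m x \<in> W C" for C
        using that iff label_eqI[OF \<xi>] by metis
    qed
    then show False using x by simp
  qed
  have "prob {x \<in> X. label \<xi> x \<noteq> \<eta> (word m x)} \<le> prob (\<Union>C\<in>\<xi>. D C)"
    using fin DE by (intro finite_measure_mono[OF sub]) auto
  also have "\<dots> \<le> (\<Sum>C\<in>\<xi>. prob (D C))"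
    using fin DE by (intro finite_measure_subadditive_finite) auto
  also have "\<dots> \<le> (\<Sum>C\<in>\<xi>. d)" using S by (intro sum_mono) (auto simp: D_def)
  finally have "prob {x \<in> X. label \<xi> x \<noteq> \<eta> (word m x)} \<le> e" using d by simp
  then show thesis by (rule that)
qed

text \<open>Kolmogorov--Sinai. Away from a set of measure e the label of x under \<xi> is a function \<eta> of a
  word of x, and Z records the label on that exceptional set, so that blocks of labels are functions
  of words and blocks of Z; the entropy of Z vanishes with e.\<close>

lemma rate_label_le:
  assumes \<xi>: "meas_partition X M \<xi>"
  shows "rate (label \<xi>) \<le> rate (\<lambda>x. x 0)"
proof -
  let ?L = "label \<xi>"
  note L = label_simple[OF \<xi>]
  note S0 = simple_function_first
  have fin: "finite \<xi>" using \<xi> by (simp add: meas_partition_def)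
  have bound: "rate ?L \<le> rate (\<lambda>x. x 0) + (e + 2 * real (card \<xi>) * sqrt e)" if e: "e > 0" for e
  proof -
    obtain m \<eta> where \<eta>: "prob {x \<in> X. ?L x \<noteq> \<eta> (word m x)} \<le> e"
      using prob_label_approximation[OF \<xi> e] by blast
    define Z where "Z x = (if ?L x = \<eta> (word m x) then None else Some (?L x))" for x
    have Z: "simple_function M Z"
      using simple_function_compose2[OF L simple_function_words[of m], of "\<lambda>l w. if l = \<eta> w then None else Some l"]
      unfolding Z_def[abs_def] .
    have "shannon M Z \<le> e + 2 * real (card \<xi>) * sqrt e"
    proof (rule shannon_option_le[OF Z _ fin])
      show "Z ` space M \<subseteq> insert None (Some ` \<xi>)"
        using label_in[OF \<xi>] by (auto simp: Z_def space_M)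
      have "Z -` (- {None}) \<inter> space M = {x \<in> X. ?L x \<noteq> \<eta> (word m x)}"
        by (auto simp: Z_def space_M split: if_splits)
      then show "prob (Z -` (- {None}) \<inter> space M) \<le> e" using \<eta> by simp
    qed
    then have ZZ: "shannon M (block Z n) \<le> real n * (e + 2 * real (card \<xi>) * sqrt e)" for n
      using shannon_block_le[OF Z, of n] mult_left_mono[of "shannon M Z" _ "real n"] by fastforce
    have le: "shannon M (block ?L n) / real n \<le> shannon M (word n) / real n
        + (shannon M (word m) / real n + (e + 2 * real (card \<xi>) * sqrt e))" if n: "n \<ge> 1" for n
    proof -
      \<comment> \<open>The label at time \<open>i\<close> is read off \<open>Z\<close> if recorded
        there, and otherwise is \<open>\<eta>\<close> of the \<open>m\<close> letters starting at
        \<open>i\<close>. These windows reach beyond time \<open>n\<close>, hence words of length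
        \<open>n + m\<close>.\<close>
      define f where "f p = map (\<lambda>i. case snd p ! i of None \<Rightarrow> \<eta> (take m (drop i (fst p))) | Some l \<Rightarrow> l) [0..<n]"
        for p :: "nat list \<times> (nat \<Rightarrow> nat) set option list"
      have "block ?L n x = f (word (n + m) x, block Z n x)" for x
      proof (rule nth_equalityI)
        fix i assume "i < length (block ?L n x)"
        then have i: "i < n" by simp
        have "take m (drop i (word (n + m) x)) = word m ((shift ^^ i) x)"
          using i by (simp add: list_eq_iff_nth_eq funpow_shift add_ac)
        then show "block ?L n x ! i = f (word (n + m) x, block Z n x) ! i"
          using i by (auto simp: f_def Z_def split: option.splits if_splits)
      qed (simp add: f_def)
      then have "block ?L n = (\<lambda>x. f (word (n + m) x, block Z n x))" by (simp add: fun_eq_iff)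
      then have "shannon M (block ?L n) \<le> shannon M (\<lambda>x. (word (n + m) x, block Z n x))"
        using shannon_compose_le[OF simple_function_Pair[OF simple_function_words[of "n + m"]
              simple_function_block[OF Z, of n]], of f] by simp
      also have "\<dots> \<le> shannon M (word (n + m)) + shannon M (block Z n)"
        by (intro shannon_Pair_le simple_function_words simple_function_block Z)
      also have "\<dots> \<le> shannon M (word n) + shannon M (word m) + real n * (e + 2 * real (card \<xi>) * sqrt e)"
        by (intro add_mono shannon_block_add S0 ZZ)
      finally have "shannon M (block ?L n) / real n \<le>
          (shannon M (word n) + shannon M (word m) + real n * (e + 2 * real (card \<xi>) * sqrt e)) / real n"
        by (intro divide_right_mono) auto
      then show ?thesis using n by (simp add: add_divide_distrib add.assoc)
    qed
    \<comment> \<open>The cost of the \<open>m\<close> extra letters does not depend on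
      \<open>n\<close> and disappears from the rate; only the entropy of \<open>Z\<close>
      remains.\<close>
    have "(\<lambda>n. shannon M (word n) / real n + (shannon M (word m) / real n + (e + 2 * real (card \<xi>) * sqrt e)))
        \<longlonglongrightarrow> rate (\<lambda>x. x 0) + (0 + (e + 2 * real (card \<xi>) * sqrt e))"
      by (intro tendsto_intros rate_LIMSEQ[OF S0] lim_const_over_n)
    then have "rate ?L \<le> rate (\<lambda>x. x 0) + (0 + (e + 2 * real (card \<xi>) * sqrt e))"
      by (rule LIMSEQ_le[OF rate_LIMSEQ[OF L]]) (use le in blast)
    then show ?thesis by simp
  qed
  have "((\<lambda>e. rate (\<lambda>x. x 0) + (e + 2 * real (card \<xi>) * sqrt e)) \<longlongrightarrow>
      rate (\<lambda>x. x 0) + (0 + 2 * real (card \<xi>) * sqrt 0)) (at_right 0)"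
    by (intro tendsto_intros)
  then have "rate ?L \<le> rate (\<lambda>x. x 0) + (0 + 2 * real (card \<xi>) * sqrt 0)"
    by (rule tendsto_lowerbound) (use bound in \<open>auto simp: eventually_at_right_less eventually_at_filter\<close>)
  then show ?thesis by simp
qed

text \<open>The supremum is a maximum, attained at the partition by first letter:
  \<open>rate_label_le\<close> bounds every partition, and conversely the cells of that partition
  determine the letters.\<close>

lemma ks_entropy_eq: "ks_entropy X M = rate (\<lambda>x. x 0)"
  unfolding ks_entropy_def
proof (rule cSup_eq_maximum)
  define \<alpha> where "\<alpha> = cyl X 1 ` X"
  define F where "F c = {y \<in> X. y 0 = c}" for c
  have cylF: "cyl X 1 x = F (x 0)" for x by (auto simp: cyl_def F_def)
  have part: "meas_partition X M \<alpha>"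
    unfolding meas_partition_def
  proof (intro conjI)
    have "hd (word 1 x) = x 0" for x :: "nat \<Rightarrow> nat" by (simp add: block_def)
    then have "\<alpha> = (\<lambda>w. F (hd w)) ` word 1 ` X"
      unfolding \<alpha>_def image_image cylF by simp
    then show "finite \<alpha>" using finite_words(1)[OF subshift, of 1] by simp
    have "F c \<in> events" for c
      using simple_functionD(2)[OF simple_function_first, of "{c}"]
      by (simp add: F_def space_M vimage_def Int_def conj_commute)
    then show "\<alpha> \<subseteq> events" unfolding \<alpha>_def cylF by (intro image_subsetI)
    show "disjoint \<alpha>" unfolding \<alpha>_def cylF by (auto simp: F_def disjoint_def)
    show "\<Union> \<alpha> = X" unfolding \<alpha>_def cylF by (auto simp: F_def)
  qed
  have lab: "label \<alpha> x = F (x 0)" if "x \<in> X" for x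
    using that unfolding \<alpha>_def[symmetric]
    by (intro label_eqI[OF part]) (unfold \<alpha>_def cylF, auto simp: F_def)
  \<comment> \<open>\<open>g\<close> reads the letter off a cell. It does so correctly only for
    cells of points of X, which suffices because \<open>shannon\<close> looks at fibres within the
    space.\<close>
  define g where "g C = (SOME c. \<exists>x\<in>C. x 0 = c)" for C :: "(nat \<Rightarrow> nat) set"
  have g: "g (label \<alpha> x) = x 0" if "x \<in> X" for x
    unfolding g_def lab[OF that] using that by (intro some_equality) (auto simp: F_def)
  have "block (\<lambda>x. g (label \<alpha> x)) n x = word n x" if "x \<in> X" for n x
    by (simp add: block_eq_iff g funpow_in that)
  then have "shannon M (block (\<lambda>x. g (label \<alpha> x)) n) = shannon M (word n)" for n
    unfolding shannon_def by (intro sum.cong image_cong arg_cong[where f="\<lambda>S. - (prob S * ln (prob S))"])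
      (auto simp: space_M)
  then have "rate (\<lambda>x. x 0) = rate (\<lambda>x. g (label \<alpha> x))" by (simp add: rate_def)
  also have "\<dots> \<le> rate (label \<alpha>)" by (rule rate_compose_le[OF label_simple[OF part]])
  finally have "rate (\<lambda>x. x 0) = entropy_rate X M \<alpha>"
    using rate_label_le[OF part] by (simp add: entropy_rate_eq part)
  then show "rate (\<lambda>x. x 0) \<in> {entropy_rate X M \<xi> |\<xi>. meas_partition X M \<xi>}" using part by blast
  show "h \<le> rate (\<lambda>x. x 0)" if "h \<in> {entropy_rate X M \<xi> |\<xi>. meas_partition X M \<xi>}" for h
    using that rate_label_le by (auto simp: entropy_rate_eq)
qed

lemma word_fibre: "x \<in> X \<Longrightarrow> word n -` {word n x} \<inter> space M = cyl X n x"
  by (auto simp: cyl_eq_word space_M)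

lemma cyl_events: "cyl X n x \<in> events"
proof -
  have "cyl X n x = word n -` {word n x} \<inter> space M" by (auto simp: cyl_eq_word space_M)
  then show ?thesis using simple_functionD(2)[OF simple_function_words, of n "{word n x}"] by simp
qed

lemma sum_words:
  "(\<Sum>w\<in>word n ` X \<inter> W. prob (word n -` {w} \<inter> space M)) = prob {x \<in> X. word n x \<in> W}"
proof -
  have "word n -` W \<inter> space M = {x \<in> X. word n x \<in> W}" by (auto simp: space_M)
  then show ?thesis using sum_prob_fibres[OF simple_function_words, of n W] by (simp only: space_M)
qed

lemma sum_all_words: "(\<Sum>w\<in>word n ` X. prob (word n -` {w} \<inter> space M)) = 1"
  using sum_words[of n UNIV] prob_space by (simp add: space_M)

section \<open>Integrals of functions with finitely many values\<close>

lemma integral_simple: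
  fixes h :: "'b \<Rightarrow> real"
  assumes L: "simple_function M L"
  shows "integrable M (\<lambda>x. h (L x))"
    "(\<integral>x. h (L x) \<partial>M) = (\<Sum>v\<in>L ` space M. h v * prob (L -` {v} \<inter> space M))"
proof -
  have fin: "finite (L ` space M)" using L by (simp add: simple_function_def)
  have ev: "L -` {v} \<inter> space M \<in> events" for v by (rule simple_functionD(2)[OF L])
  let ?s = "\<lambda>x. \<Sum>v\<in>L ` space M. h v * indicator (L -` {v} \<inter> space M) x"
  have eq: "h (L x) = ?s x" if "x \<in> space M" for x
  proof -
    have "?s x = (\<Sum>v\<in>L ` space M. if v = L x then h v else 0)"
      using that by (intro sum.cong) (auto simp: indicator_def)
    then show ?thesis using fin that by simp
  qed
  have int: "integrable M (\<lambda>x. h v * indicator (L -` {v} \<inter> space M) x)" for v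
    using ev by (intro integrable_mult_right integrable_real_indicator) (simp_all add: emeasure_eq_measure)
  have "integrable M ?s" using int by (intro Bochner_Integration.integrable_sum)
  then show "integrable M (\<lambda>x. h (L x))" using eq by (subst Bochner_Integration.integrable_cong[OF refl, of _ _ ?s])
  have "(\<integral>x. h (L x) \<partial>M) = (\<integral>x. ?s x \<partial>M)" using eq by (intro Bochner_Integration.integral_cong) auto
  also have "\<dots> = (\<Sum>v\<in>L ` space M. \<integral>x. h v * indicator (L -` {v} \<inter> space M) x \<partial>M)"
    using int by (intro Bochner_Integration.integral_sum)
  also have "\<dots> = (\<Sum>v\<in>L ` space M. h v * prob (L -` {v} \<inter> space M))"
    by (simp add: Int_commute Int_absorb1)
  finally show "(\<integral>x. h (L x) \<partial>M) = (\<Sum>v\<in>L ` space M. h v * prob (L -` {v} \<inter> space M))" .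
qed

lemma integral_shift:
  fixes h :: "'b \<Rightarrow> real"
  assumes L: "simple_function M L"
  shows "(\<integral>x. h (L ((shift ^^ n) x)) \<partial>M) = (\<integral>x. h (L x) \<partial>M)"
proof -
  let ?S = "\<lambda>x. L ((shift ^^ n) x)"
  have sub: "?S ` space M \<subseteq> L ` space M" unfolding space_M using funpow_in by blast
  have "prob (L -` {v} \<inter> space M) = 0" if "v \<in> L ` space M - ?S ` space M" for v
  proof -
    have "?S -` {v} \<inter> space M = {}" using that by blast
    then show ?thesis using prob_shift_fibre[OF L, of n v] by simp
  qed
  then show ?thesis
    unfolding integral_simple(2)[OF L] integral_simple(2)[OF simple_function_shift[OF L]]
      prob_shift_fibre[OF L] using sub L
    by (intro sum.mono_neutral_left) (auto simp: simple_function_def)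
qed

end

section \<open>Uniqueness for ergodic measures with quasi-multiplicative cylinder masses\<close>

text \<open>A distance above \<open>(1/2) ^ L\<close> after \<open>i < n\<close> shifts shows as a
  disagreement at an index \<open>i + j\<close> with \<open>j < L\<close>.\<close>

lemma inj_on_words_of_separated:
  assumes "n \<ge> 1" "(1/2) ^ L \<le> \<epsilon>" "separated Y n \<epsilon> E"
  shows "inj_on (word (n + L)) E"
proof (rule inj_onI, rule ccontr)
  fix x y assume E: "x \<in> E" "y \<in> E" and eq: "word (n + L) x = word (n + L) y" and "x \<noteq> y"
  then obtain i where i: "i < n" "sdist ((shift ^^ i) x) ((shift ^^ i) y) > \<epsilon>"
    using assms(3) unfolding separated_def by blast
  have "(0::real) < (1/2) ^ L" by simp
  then have "\<epsilon> > 0" using assms(2) by linarith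
  have ne: "(shift ^^ i) x \<noteq> (shift ^^ i) y"
  proof
    assume "(shift ^^ i) x = (shift ^^ i) y"
    then have "sdist ((shift ^^ i) x) ((shift ^^ i) y) = 0" unfolding sdist_def by (rule if_P)
    then show False using i(2) \<open>\<epsilon> > 0\<close> by linarith
  qed
  define j where "j = (LEAST j. (shift ^^ i) x j \<noteq> (shift ^^ i) y j)"
  have j: "(shift ^^ i) x j \<noteq> (shift ^^ i) y j"
    unfolding j_def by (rule LeastI_ex[of "\<lambda>j. (shift ^^ i) x j \<noteq> (shift ^^ i) y j"])
      (use ne in \<open>simp add: fun_eq_iff\<close>)
  have "sdist ((shift ^^ i) x) ((shift ^^ i) y) = (1/2) ^ j"
    unfolding sdist_def j_def by (rule if_not_P[OF ne])
  then have "(1/2::real) ^ L < (1/2) ^ j" using i(2) assms(2) by linarith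
  then have "j < L" by (simp add: power_strict_decreasing_iff)
  then have "i + j < n + L" using i(1) by simp
  then have "x (i + j) = y (i + j)" using eq by (simp add: word_eq_iff)
  then show False using j by (simp add: funpow_shift)
qed

text \<open>Shifting a disagreement at some \<open>i < n\<close> to the front makes the distance
  equal to 1.\<close>

lemma separated_of_words_differ:
  assumes "finite E" "E \<subseteq> Y" "inj_on (word n) E" "\<epsilon> < 1"
  shows "separated Y n \<epsilon> E"
  unfolding separated_def
proof (intro conjI assms ballI impI)
  fix x y assume "x \<in> E" "y \<in> E" "x \<noteq> y"
  then have "word n x \<noteq> word n y" using assms(3) by (auto dest: inj_onD)
  then obtain i where i: "i < n" "x i \<noteq> y i" by (auto simp: word_eq_iff)
  let ?x = "(shift ^^ i) x" and ?y = "(shift ^^ i) y"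
  have ne0: "?x 0 \<noteq> ?y 0" using i(2) by (simp add: funpow_shift)
  then have "?x \<noteq> ?y" by (metis)
  moreover have "(LEAST j. ?x j \<noteq> ?y j) = 0" using ne0 by (rule Least_eq_0)
  ultimately have "sdist ?x ?y = 1" by (simp add: sdist_def)
  then show "\<exists>i<n. sdist ((shift ^^ i) x) ((shift ^^ i) y) > \<epsilon>" using i(1) assms(4) by auto
qed

text \<open>This collects what the entropy argument takes from the factor measure.
  \<open>exp_lower\<close> makes the logarithmic integrals decrease at most linearly, so their rates
  are finite. \<open>ergodic\<close> is stated for sets that are invariant up to null sets, since no
  more is obtained for the superlevel set of a density.\<close>

locale quasi_gibbs = invariant_subshift k Y \<nu> for k Y \<nu> +
  fixes G :: "nat \<Rightarrow> (nat \<Rightarrow> nat) \<Rightarrow> real" and K c :: real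
  assumes K1: "K \<ge> 1" and c0: "c > 0"
    and G_word: "\<And>n x y. x \<in> Y \<Longrightarrow> y \<in> Y \<Longrightarrow> word n x = word n y \<Longrightarrow> G n x = G n y"
    and G_upper: "\<And>n y. n \<ge> 1 \<Longrightarrow> y \<in> Y \<Longrightarrow> G n y \<le> K * measure \<nu> (cyl Y n y)"
    and G_lower: "\<And>n y. n \<ge> 1 \<Longrightarrow> y \<in> Y \<Longrightarrow> measure \<nu> (cyl Y n y) \<le> K * G n y"
    and quasi: "\<And>n m y. n \<ge> 1 \<Longrightarrow> m \<ge> 1 \<Longrightarrow> y \<in> Y \<Longrightarrow> measure \<nu> (cyl Y (n + m) y)
        \<le> K * measure \<nu> (cyl Y n y) * measure \<nu> (cyl Y m ((shift ^^ n) y))"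
    and exp_lower: "\<And>n y. n \<ge> 1 \<Longrightarrow> y \<in> Y \<Longrightarrow> c ^ n \<le> measure \<nu> (cyl Y n y)"
    and ergodic: "\<And>A. A \<in> sets \<nu> \<Longrightarrow> measure \<nu> (A - shift -` A) = 0 \<Longrightarrow>
        measure \<nu> (shift -` A \<inter> Y - A) = 0 \<Longrightarrow> measure \<nu> A = 0 \<or> measure \<nu> A = 1"
begin

section \<open>Word masses, zero pressure and the Gibbs property\<close>

abbreviation wp :: "nat \<Rightarrow> nat list \<Rightarrow> real" where
  "wp n w \<equiv> measure \<nu> (word n -` {w} \<inter> space \<nu>)"

lemma wp_word: "y \<in> Y \<Longrightarrow> wp n (word n y) = measure \<nu> (cyl Y n y)"
  by (simp add: word_fibre)

lemma cyl_pos: "n \<ge> 1 \<Longrightarrow> y \<in> Y \<Longrightarrow> measure \<nu> (cyl Y n y) > 0"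
  using less_le_trans[OF zero_less_power[OF c0, of n] exp_lower[of n y]] by simp

lemma wp_pos: "n \<ge> 1 \<Longrightarrow> w \<in> word n ` Y \<Longrightarrow> wp n w > 0"
  by (erule imageE) (simp only: wp_word cyl_pos)

lemma G_pos: "n \<ge> 1 \<Longrightarrow> y \<in> Y \<Longrightarrow> G n y > 0"
  using less_le_trans[OF cyl_pos G_lower, of n y] K1 by (simp add: zero_less_mult_iff)

lemma sum_wp: "(\<Sum>w\<in>word n ` Y. wp n w) = 1"
  by (rule sum_all_words)

lemma fin_words: "finite (word n ` Y)"
  by (rule finite_words(1)[OF subshift])

lemma Y_nonempty: "Y \<noteq> {}"
  using subshift by (simp add: subshift_def)

lemma k_pos: "k \<ge> 1"
proof -
  obtain y where "y \<in> Y" using Y_nonempty by blast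
  then show ?thesis using subshift_letter[OF subshift, of y 0] by simp
qed

text \<open>Points of \<open>E\<close> with the same first \<open>n\<close> letters are told apart
  by the next \<open>L\<close> letters, so each n-word is used at most \<open>k ^ L\<close> times,
  while the masses of all n-words sum to 1.\<close>

lemma separated_sum_le:
  assumes n: "n \<ge> 1" and L: "(1/2) ^ L \<le> \<epsilon>" and E: "separated Y n \<epsilon> E"
  shows "(\<Sum>x\<in>E. G n x) \<le> K * real k ^ L"
proof -
  have fin: "finite E" and EY: "E \<subseteq> Y" using E by (auto simp: separated_def)
  note inj = inj_on_words_of_separated[OF n L E]
  have card: "card {x \<in> E. word n x = w} \<le> k ^ L" for w
  proof -
    have "inj_on (\<lambda>x. word L ((shift ^^ n) x)) {x \<in> E. word n x = w}"
    proof (rule inj_onI)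
      fix x y assume xy: "x \<in> {x \<in> E. word n x = w}" "y \<in> {x \<in> E. word n x = w}"
        and "word L ((shift ^^ n) x) = word L ((shift ^^ n) y)"
      then have "word (n + L) x = word (n + L) y" by (simp add: block_add)
      then show "x = y" using inj xy by (auto dest: inj_onD)
    qed
    moreover have "(\<lambda>x. word L ((shift ^^ n) x)) ` {x \<in> E. word n x = w} \<subseteq> word L ` Y"
      using EY funpow_in by blast
    ultimately have "card {x \<in> E. word n x = w} \<le> card (word L ` Y)"
      using fin_words by (rule card_inj_on_le)
    then show ?thesis using finite_words(2)[OF subshift, of L] by linarith
  qed
  have "(\<Sum>x\<in>E. G n x) \<le> (\<Sum>x\<in>E. K * wp n (word n x))"
    using EY G_upper[OF n] by (intro sum_mono) (auto simp: wp_word)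
  also have "\<dots> = K * (\<Sum>x\<in>E. wp n (word n x))" by (simp add: sum_distrib_left)
  also have "(\<Sum>x\<in>E. wp n (word n x)) = (\<Sum>w\<in>word n ` E. \<Sum>x\<in>{x \<in> E. word n x = w}. wp n (word n x))"
    by (rule sum.image_gen[OF fin])
  also have "\<dots> = (\<Sum>w\<in>word n ` E. real (card {x \<in> E. word n x = w}) * wp n w)"
    by (intro sum.cong refl) simp
  also have "\<dots> \<le> (\<Sum>w\<in>word n ` E. real k ^ L * wp n w)"
    using card by (intro sum_mono mult_right_mono) (simp_all flip: of_nat_power)
  also have "\<dots> \<le> (\<Sum>w\<in>word n ` Y. real k ^ L * wp n w)"
    using EY fin_words by (intro sum_mono2) auto
  also have "\<dots> = real k ^ L" using sum_wp by (simp flip: sum_distrib_left)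
  finally show ?thesis using K1 by simp
qed

text \<open>One representative per n-word: the word masses sum to 1 and each is at most
  \<open>K\<close> times the value of \<open>G\<close>.\<close>

lemma separated_sum_ge:
  assumes n: "n \<ge> 1" and \<epsilon>: "\<epsilon> < 1"
  obtains E where "separated Y n \<epsilon> E" "1 / K \<le> (\<Sum>x\<in>E. G n x)"
proof -
  define E where "E = inv_into Y (word n) ` word n ` Y"
  have EY: "E \<subseteq> Y" unfolding E_def by (auto intro: inv_into_into)
  have img: "word n ` E = word n ` Y" unfolding E_def
    by (auto simp: image_image f_inv_into_f intro: rev_image_eqI)
  have inj: "inj_on (word n) E"
    unfolding E_def by (rule inj_onI) (auto simp: f_inv_into_f)
  have fin: "finite E" unfolding E_def using fin_words by simp
  have "1 = (\<Sum>w\<in>word n ` E. wp n w)" using sum_wp img by simp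
  also have "\<dots> = (\<Sum>x\<in>E. wp n (word n x))" using inj by (simp add: sum.reindex)
  also have "\<dots> \<le> (\<Sum>x\<in>E. K * G n x)"
    using EY G_lower[OF n] by (intro sum_mono) (auto simp: wp_word)
  finally have "1 / K \<le> (\<Sum>x\<in>E. G n x)" using K1 by (simp add: field_simps sum_distrib_left)
  with separated_of_words_differ[OF fin EY inj \<epsilon>] show thesis by (rule that)
qed

text \<open>At a fixed scale the partition sums stay between \<open>1 / K\<close> and
  \<open>K * real k ^ L\<close> with \<open>L\<close> independent of \<open>n\<close>. The growth
  rate is thus 0 at every scale below 1, and the limit in \<open>\<epsilon>\<close> is that of an
  eventually constant function.\<close>

lemma pressure_zero: "pressure Y G = 0"
proof -
  let ?S = "\<lambda>n \<epsilon>. {(\<Sum>x\<in>E. G n x) | E. separated Y n \<epsilon> E}"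
  have lim0: "Limsup sequentially (\<lambda>n. ereal (ln (Sup (?S n \<epsilon>)) / real n)) = 0"
    if \<epsilon>: "\<epsilon> \<in> {0<..<1}" for \<epsilon> :: real
  proof -
    obtain L where "(1/2) ^ L < \<epsilon>" using \<epsilon> real_arch_pow_inv[of \<epsilon> "1/2"] by auto
    then have L: "(1/2) ^ L \<le> \<epsilon>" by simp
    have kL: "real k ^ L > 0" using k_pos by simp
    have bounds: "ln (1 / K) \<le> ln (Sup (?S n \<epsilon>)) \<and> ln (Sup (?S n \<epsilon>)) \<le> ln (K * real k ^ L)"
      if n: "n \<ge> 1" for n
    proof -
      obtain E where E: "separated Y n \<epsilon> E" "1 / K \<le> (\<Sum>x\<in>E. G n x)"
        using separated_sum_ge[OF n, of \<epsilon>] \<epsilon> by auto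
      have up: "s \<le> K * real k ^ L" if "s \<in> ?S n \<epsilon>" for s
        using that separated_sum_le[OF n L] by auto
      have "bdd_above (?S n \<epsilon>)" using up by (rule bdd_aboveI)
      then have "(\<Sum>x\<in>E. G n x) \<le> Sup (?S n \<epsilon>)" using E(1) by (intro cSup_upper) auto
      then have lo: "1 / K \<le> Sup (?S n \<epsilon>)" using E(2) by linarith
      have "Sup (?S n \<epsilon>) \<le> K * real k ^ L" using up E(1) by (intro cSup_least) auto
      moreover have "1 / K > 0" using K1 by simp
      ultimately show ?thesis using lo K1 kL by (smt (verit) ln_le_cancel_iff)
    qed
    have "(\<lambda>n. ln (Sup (?S n \<epsilon>)) / real n) \<longlonglongrightarrow> 0"
    proof (rule tendsto_sandwich)
      show "(\<lambda>n. ln (1 / K) / real n) \<longlonglongrightarrow> 0" "(\<lambda>n. ln (K * real k ^ L) / real n) \<longlonglongrightarrow> 0"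
        by (rule lim_const_over_n)+
      show "\<forall>\<^sub>F n in sequentially. ln (1 / K) / real n \<le> ln (Sup (?S n \<epsilon>)) / real n"
        using eventually_ge_at_top[of 1] by eventually_elim (use bounds in \<open>auto intro!: divide_right_mono\<close>)
      show "\<forall>\<^sub>F n in sequentially. ln (Sup (?S n \<epsilon>)) / real n \<le> ln (K * real k ^ L) / real n"
        using eventually_ge_at_top[of 1] by eventually_elim (use bounds in \<open>auto intro!: divide_right_mono\<close>)
    qed
    then have "(\<lambda>n. ereal (ln (Sup (?S n \<epsilon>)) / real n)) \<longlonglongrightarrow> ereal 0"
      by (rule tendsto_ereal)
    then show ?thesis unfolding zero_ereal_def by (rule lim_imp_Limsup[OF sequentially_bot])
  qed
  have "((\<lambda>\<epsilon>. Limsup sequentially (\<lambda>n. ereal (ln (Sup (?S n \<epsilon>)) / real n))) \<longlongrightarrow> 0) (at_right 0)"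
    by (rule tendsto_eventually) (use lim0 in \<open>auto intro: eventually_mono[OF eventually_at_right_real[of 0 1]]\<close>)
  then show ?thesis unfolding pressure_def by (intro tendsto_Lim) auto
qed

lemma gibbs_nu: "gibbs Y G \<nu>"
  unfolding gibbs_def
proof (intro exI conjI allI impI ballI)
  show "pressure Y G = ereal 0" using pressure_zero by (simp add: zero_ereal_def)
  \<comment> \<open>The comparisons with \<open>K\<close> are weak inequalities and the Gibbs
    property demands strict ones, hence the factor 2.\<close>
  show "2 * K > 0" using K1 by simp
  fix n :: nat and y assume ny: "n \<ge> 1" "y \<in> Y"
  note * = G_pos[OF ny] cyl_pos[OF ny] G_upper[OF ny] G_lower[OF ny]
  have "G n y < measure \<nu> (cyl Y n y) * (2 * K)" using * K1 by (simp add: mult.commute)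
  then show "inverse (2 * K) < measure \<nu> (cyl Y n y) / (exp (- (real n * 0)) * G n y)"
    using * K1 by (simp add: field_simps)
  have "measure \<nu> (cyl Y n y) < 2 * K * G n y" using * K1 by simp
  then show "measure \<nu> (cyl Y n y) / (exp (- (real n * 0)) * G n y) < 2 * K"
    using * K1 by (simp add: field_simps)
qed

text \<open>This is minus the relative entropy of N with respect to \<open>\<nu>\<close> on the algebra of n-words.\<close>

definition relEnt :: "nat \<Rightarrow> (nat \<Rightarrow> nat) measure \<Rightarrow> real" where
  "relEnt n N = (\<Sum>w\<in>word n ` Y. measure N (word n -` {w} \<inter> space N) * ln (wp n w))
     + shannon N (word n)"

text \<open>A variational bound of Donsker-Varadhan type: Gibbs' inequality against the masses of
  \<open>\<nu>\<close> multiplied by \<open>t\<close> on \<open>W\<close>. The tilt gains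
  \<open>ln t\<close> times the N-mass of \<open>W\<close> and raises the total mass by
  \<open>t - 1\<close> times the \<open>\<nu>\<close>-mass. At \<open>t = 1\<close> it says that
  relative entropy is nonnegative.\<close>

lemma relEnt_le:
  assumes "invariant_subshift k Y N" and n: "n \<ge> 1"
    and t: "t \<ge> 1"
  shows "relEnt n N + ln t * measure N {y \<in> Y. word n y \<in> W} \<le> (t - 1) * measure \<nu> {y \<in> Y. word n y \<in> W}"
proof -
  interpret N: invariant_subshift k Y N by fact
  let ?p = "\<lambda>w. measure N (word n -` {w} \<inter> space N)"
  let ?q = "\<lambda>w. wp n w * (if w \<in> W then t else 1)"
  have sp: "(\<Sum>w\<in>word n ` Y. ?p w) = 1"
    by (rule N.sum_all_words)
  have spW: "(\<Sum>w\<in>word n ` Y \<inter> W. ?p w) = measure N {y \<in> Y. word n y \<in> W}"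
    by (rule N.sum_words)
  have sqW: "(\<Sum>w\<in>word n ` Y \<inter> W. wp n w) = measure \<nu> {y \<in> Y. word n y \<in> W}"
    by (rule sum_words)
  have "(\<Sum>w\<in>word n ` Y. ?p w * ln (?q w)) + (\<Sum>w\<in>word n ` Y. - (?p w * ln (?p w)))
      \<le> (\<Sum>w\<in>word n ` Y. ?q w) - (\<Sum>w\<in>word n ` Y. ?p w)"
    using wp_pos[OF n] t by (intro gibbs_inequality) (auto simp: less_le split: if_splits)
  moreover have "(\<Sum>w\<in>word n ` Y. ?p w * ln (?q w)) =
      (\<Sum>w\<in>word n ` Y. ?p w * ln (wp n w)) + ln t * measure N {y \<in> Y. word n y \<in> W}"
  proof -
    have "?p w * ln (?q w) = ?p w * ln (wp n w) + (if w \<in> W then ln t * ?p w else 0)"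
      if "w \<in> word n ` Y" for w
      using wp_pos[OF n that] t by (simp add: ln_mult algebra_simps)
    then have "(\<Sum>w\<in>word n ` Y. ?p w * ln (?q w)) =
        (\<Sum>w\<in>word n ` Y. ?p w * ln (wp n w) + (if w \<in> W then ln t * ?p w else 0))"
      by (intro sum.cong) auto
    also have "\<dots> = (\<Sum>w\<in>word n ` Y. ?p w * ln (wp n w)) + (\<Sum>w\<in>word n ` Y \<inter> W. ln t * ?p w)"
      using fin_words by (simp add: sum.distrib sum.inter_restrict)
    finally show ?thesis by (simp add: spW flip: sum_distrib_left)
  qed
  moreover have "(\<Sum>w\<in>word n ` Y. ?q w) = 1 + (t - 1) * measure \<nu> {y \<in> Y. word n y \<in> W}"
  proof -
    have "(\<Sum>w\<in>word n ` Y. ?q w) = (\<Sum>w\<in>word n ` Y. wp n w + (if w \<in> W then (t - 1) * wp n w else 0))"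
      by (intro sum.cong) (auto simp: algebra_simps)
    also have "\<dots> = (\<Sum>w\<in>word n ` Y. wp n w) + (\<Sum>w\<in>word n ` Y \<inter> W. (t - 1) * wp n w)"
      using fin_words by (simp add: sum.distrib sum.inter_restrict)
    finally show ?thesis by (simp add: sum_wp sqW flip: sum_distrib_left)
  qed
  moreover have "shannon N (word n) = (\<Sum>w\<in>word n ` Y. - (?p w * ln (?p w)))"
    by (simp add: shannon_def N.space_M)
  ultimately show ?thesis using sp by (simp add: relEnt_def)
qed

text \<open>For fixed \<open>t\<close>, approximating a \<open>\<nu>\<close>-null set by word sets
  in both measures leaves \<open>ln t\<close> times its N-mass at most \<open>B\<close>; then
  \<open>t\<close> is sent to infinity. The lengths of the approximating words are not controlled,
  so \<open>B\<close> must be uniform in \<open>n\<close>.\<close>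

lemma abs_cont_of_relEnt:
  assumes N: "invariant_subshift k Y N" and B: "\<And>n. n \<ge> 1 \<Longrightarrow> - B \<le> relEnt n N"
    and A: "A \<in> sets \<nu>" "measure \<nu> A = 0"
  shows "measure N A = 0"
proof -
  interpret N: invariant_subshift k Y N by fact
  have sN: "sets N = sets \<nu>" by (simp add: N.sets_M sets_M)
  have ws: "ln t * measure N S \<le> B + t * measure \<nu> S" if S: "word_set Y S" and t: "t \<ge> 1" for S t
  proof -
    obtain n W where "S = {y \<in> Y. word n y \<in> W}" using S by (auto simp: word_set_def)
    \<comment> \<open>The given length may be 0, whereas \<open>relEnt_le\<close> starts at length
      1.\<close>
    then have S': "S = {y \<in> Y. word (Suc n) y \<in> take n -` W}"
      using word_set_extend[of n "Suc n" Y W] by simp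
    have "relEnt (Suc n) N + ln t * measure N S \<le> (t - 1) * measure \<nu> S"
      unfolding S' by (rule relEnt_le[OF N _ t]) simp
    moreover have "(t - 1) * measure \<nu> S \<le> t * measure \<nu> S" by (intro mult_right_mono) auto
    ultimately show ?thesis using B[of "Suc n"] by simp
  qed
  have lnt: "ln t * measure N A \<le> B" if t: "t \<ge> 1" for t
  proof (rule field_le_epsilon)
    fix e :: real assume e: "e > 0"
    \<comment> \<open>Chosen so that the error \<open>ln t * d\<close> from N and the error
      \<open>t * d\<close> from \<open>\<nu>\<close> together stay below \<open>e\<close>.\<close>
    define d where "d = e / (ln t + t + 1)"
    have lt: "ln t \<ge> 0" using t by simp
    then have pos: "ln t + t + 1 > 0" using t by linarith
    then have d0: "d > 0" using e by (simp add: d_def)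
    have "(ln t + t + 1) * d = e" using pos by (simp add: d_def)
    then have "ln t * d + t * d \<le> e" using d0 by (simp add: algebra_simps)
    note d = d0 this
    obtain S where S: "word_set Y S" "measure N (A - S \<union> (S - A)) \<le> d" "measure \<nu> (A - S \<union> (S - A)) \<le> d"
      using word_set_approximation[OF subshift N.finite_measure_axioms finite_measure_axioms
          N.sets_M sets_M _ d(1), of A] A(1) by (auto simp: sN)
    have SE: "S \<in> sets \<nu>" by (rule word_set_sets[OF subshift sets_M S(1)])
    have "measure N A \<le> measure N (S \<union> (A - S \<union> (S - A)))"
      using SE A(1) by (intro N.finite_measure_mono) (auto simp: sN)
    also have "\<dots> \<le> measure N S + measure N (A - S \<union> (S - A))"
      using SE A(1) by (intro measure_Un_le) (auto simp: sN)
    finally have 1: "measure N A \<le> measure N S + d" using S(2) by linarith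
    have "measure \<nu> S \<le> measure \<nu> (A \<union> (A - S \<union> (S - A)))"
      using SE A(1) by (intro finite_measure_mono) auto
    also have "\<dots> \<le> measure \<nu> A + measure \<nu> (A - S \<union> (S - A))"
      using SE A(1) by (intro measure_Un_le) auto
    finally have 2: "measure \<nu> S \<le> d" using S(3) A(2) by linarith
    have "ln t * measure N A \<le> ln t * (measure N S + d)" using 1 lt by (rule mult_left_mono)
    also have "\<dots> = ln t * measure N S + ln t * d" by (simp add: algebra_simps)
    also have "\<dots> \<le> B + t * measure \<nu> S + ln t * d" using ws[OF S(1) t] by simp
    also have "\<dots> \<le> B + t * d + ln t * d" using 2 t by simp
    finally show "ln t * measure N A \<le> B + e" using d(2) by linarith
  qed
  show ?thesis
  proof (rule ccontr)
    assume "measure N A \<noteq> 0"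
    then have pos: "measure N A > 0" by (simp add: less_le)
    define t where "t = exp ((\<bar>B\<bar> + 1) / measure N A)"
    have "ln t * measure N A = \<bar>B\<bar> + 1" using pos by (simp add: t_def)
    moreover have "t \<ge> 1" using pos by (simp add: t_def)
    ultimately show False using lnt[of t] by linarith
  qed
qed

text \<open>Let \<open>A\<close> be the set where the density exceeds 1 and \<open>T\<close> its
  preimage. By invariance each of the two measures gives \<open>A - T\<close> and
  \<open>T - A\<close> the same mass. N is at most \<open>\<nu>\<close> on \<open>T - A\<close>, but
  strictly larger on non-null subsets of \<open>A\<close>; so \<open>A\<close> is invariant up to
  null sets. Ergodicity leaves measure 0 or 1, and measure 1 would force N to have mass above
  1.\<close>

lemma eq_of_abs_cont:
  assumes N: "invariant_subshift k Y N" and ac: "\<And>A. A \<in> sets \<nu> \<Longrightarrow> measure \<nu> A = 0 \<Longrightarrow> measure N A = 0"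
  shows "N = \<nu>"
proof -
  interpret N: invariant_subshift k Y N by fact
  have sN: "sets N = sets \<nu>" by (simp add: N.sets_M sets_M)
  have "absolutely_continuous \<nu> N"
    unfolding absolutely_continuous_def
  proof
    fix A assume "A \<in> null_sets \<nu>"
    then have A: "A \<in> sets \<nu>" "measure \<nu> A = 0" by (auto simp: null_sets_def measure_def)
    then show "A \<in> null_sets N" using ac[OF A] sN by (auto simp: null_sets_def N.emeasure_eq_measure)
  qed
  then obtain h where h[measurable]: "h \<in> borel_measurable \<nu>" and dens: "density \<nu> h = N"
    using Radon_Nikodym[of N] sN by auto
  have emN: "emeasure N A = (\<integral>\<^sup>+x. h x * indicator A x \<partial>\<nu>)" if "A \<in> sets \<nu>" for A
    unfolding dens[symmetric] using that by (simp add: emeasure_density)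
  define A where "A = {y \<in> space \<nu>. h y > 1}"
  have A[measurable]: "A \<in> sets \<nu>" unfolding A_def by simp
  have AY: "A \<subseteq> Y" by (auto simp: A_def space_M)
  \<comment> \<open>The integral of \<open>h - 1\<close> over \<open>S\<close> must then vanish,
    although the integrand is positive on \<open>S\<close>.\<close>
  have big: "measure \<nu> S = 0" if S[measurable]: "S \<in> sets \<nu>" and "S \<subseteq> A" and le: "measure N S \<le> measure \<nu> S" for S
  proof -
    have "(\<integral>\<^sup>+x. (h x - 1) * indicator S x \<partial>\<nu>) + (\<integral>\<^sup>+x. indicator S x \<partial>\<nu>) =
        (\<integral>\<^sup>+x. (h x - 1) * indicator S x + indicator S x \<partial>\<nu>)"
      by (intro nn_integral_add[symmetric]) auto
    also have "\<dots> = (\<integral>\<^sup>+x. h x * indicator S x \<partial>\<nu>)"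
      using \<open>S \<subseteq> A\<close> by (intro nn_integral_cong)
        (auto simp: indicator_def A_def diff_add_cancel_ennreal)
    also have "\<dots> = emeasure N S" using emN[OF S] by simp
    also have "\<dots> \<le> emeasure \<nu> S" using le by (simp add: emeasure_eq_measure N.emeasure_eq_measure)
    finally have "(\<integral>\<^sup>+x. (h x - 1) * indicator S x \<partial>\<nu>) + emeasure \<nu> S \<le> 0 + emeasure \<nu> S" by simp
    then have "(\<integral>\<^sup>+x. (h x - 1) * indicator S x \<partial>\<nu>) = 0"
      by (simp add: ennreal_add_left_cancel_le emeasure_eq_measure add.commute)
    then have "AE x in \<nu>. (h x - 1) * indicator S x = 0"
      by (subst (asm) nn_integral_0_iff_AE) auto
    then have "AE x in \<nu>. x \<notin> S"
      by (rule eventually_mono) (use \<open>S \<subseteq> A\<close> in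
        \<open>auto simp: A_def indicator_def dest!: ennreal_minus_eq_0 split: if_splits\<close>)
    then have "S \<in> null_sets \<nu>" using AE_iff_null_sets[OF S] by simp
    then show ?thesis by (simp add: null_sets_def measure_def)
  qed
  have small: "measure N S \<le> measure \<nu> S" if S[measurable]: "S \<in> sets \<nu>" and "S \<inter> A = {}" for S
  proof -
    have "emeasure N S = (\<integral>\<^sup>+x. h x * indicator S x \<partial>\<nu>)" by (rule emN[OF S])
    also have "\<dots> \<le> (\<integral>\<^sup>+x. indicator S x \<partial>\<nu>)"
      using that by (intro nn_integral_mono) (auto simp: indicator_def A_def not_less)
    finally show ?thesis by (simp add: emeasure_eq_measure N.emeasure_eq_measure)
  qed
  define T where "T = {y \<in> Y. (shift ^^ 1) y \<in> A}"
  have T: "T \<in> sets \<nu>" "measure \<nu> T = measure \<nu> A" "measure N T = measure N A"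
    using shift_preimage[OF A, of 1] N.shift_preimage[of A 1] A by (auto simp: T_def sN)
  have T': "A - shift -` A = A - T" "shift -` A \<inter> Y - A = T - A" using AY by (auto simp: T_def)
  have d: "measure R (A - T) = measure R (T - A)" if "finite_measure R" "sets R = sets \<nu>" "measure R T = measure R A" for R
  proof -
    interpret R: finite_measure R by fact
    have "measure R (A - T) = measure R A - measure R (A \<inter> T)"
      using A T that(2) R.finite_measure_Diff'[of A T] by simp
    moreover have "measure R (T - A) = measure R T - measure R (T \<inter> A)"
      using A T that(2) R.finite_measure_Diff'[of T A] by simp
    ultimately show ?thesis using that(3) by (simp add: Int_commute)
  qed
  have "measure N (A - T) = measure N (T - A)" using T sN N.finite_measure_axioms by (intro d) auto
  also have "\<dots> \<le> measure \<nu> (T - A)" using A T by (intro small) auto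
  also have d\<nu>: "\<dots> = measure \<nu> (A - T)" using T finite_measure_axioms by (intro d[symmetric]) auto
  finally have "measure \<nu> (A - T) = 0" using A T by (intro big) auto
  then have "measure \<nu> A = 0 \<or> measure \<nu> A = 1"
    using d\<nu> by (intro ergodic[OF A]) (simp_all add: T')
  then have A0: "measure \<nu> A = 0" using big[OF A] N.prob_le_1[of A] by auto
  \<comment> \<open>With \<open>A\<close> null for both measures, N is dominated by
    \<open>\<nu>\<close> everywhere; applied to complements, this gives equality, as both have mass
    1.\<close>
  have le: "measure N S \<le> measure \<nu> S" if S: "S \<in> sets \<nu>" for S
  proof -
    have "measure N S \<le> measure N ((S - A) \<union> A)"
      using S A by (intro N.finite_measure_mono) (auto simp: sN)
    also have "\<dots> \<le> measure N (S - A) + measure N A"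
      using S A by (intro measure_Un_le) (auto simp: sN)
    also have "\<dots> \<le> measure \<nu> (S - A) + 0" using S A ac[OF A A0] by (intro add_mono small) auto
    also have "\<dots> \<le> measure \<nu> S + 0" using S A by (intro add_mono finite_measure_mono) auto
    finally show ?thesis by simp
  qed
  have "measure N S = measure \<nu> S" if S: "S \<in> sets \<nu>" for S
  proof -
    have "1 - measure N S \<le> 1 - measure \<nu> S"
      using le[OF sets.compl_sets[OF S]] S prob_compl[OF S] N.prob_compl[of S] sN
      by (simp add: space_M N.space_M)
    then show ?thesis using le[OF S] by simp
  qed
  then show ?thesis using sN
    by (intro measure_eqI) (auto simp: emeasure_eq_measure N.emeasure_eq_measure)
qed

lemma eq_of_relEnt:
  assumes "invariant_subshift k Y N" "\<And>n. n \<ge> 1 \<Longrightarrow> - B \<le> relEnt n N"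
  shows "N = \<nu>"
  using abs_cont_of_relEnt[OF assms] by (intro eq_of_abs_cont assms(1)) auto

text \<open>Cylinder masses of N exceed those of \<open>\<nu>\<close> at most by the factor
  \<open>C * K\<close>, so the relative entropy on words is at most the logarithm of this factor,
  whatever the length.\<close>

lemma unique_gibbs:
  assumes N: "invariant_subshift k Y N" and g: "gibbs Y G N"
  shows "N = \<nu>"
proof -
  interpret N: invariant_subshift k Y N by fact
  obtain C where C: "C > 0" and up: "\<And>n y. n \<ge> 1 \<Longrightarrow> y \<in> Y \<Longrightarrow> measure N (cyl Y n y) / G n y < C"
    using g pressure_zero unfolding gibbs_def by (auto simp: zero_ereal_def)
  let ?p = "\<lambda>n w. measure N (word n -` {w} \<inter> space N)"
  have "- \<bar>ln (C * K)\<bar> \<le> relEnt n N" if n: "n \<ge> 1" for n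
  proof -
    have le: "?p n w \<le> C * K * wp n w" if w: "w \<in> word n ` Y" for w
    proof -
      obtain y where y: "y \<in> Y" "w = word n y" using w by auto
      have "measure N (cyl Y n y) \<le> C * G n y" using up[OF n y(1)] G_pos[OF n y(1)] by (simp add: field_simps)
      also have "\<dots> \<le> C * (K * measure \<nu> (cyl Y n y))" using G_upper[OF n y(1)] C by simp
      finally show ?thesis by (simp add: y word_fibre N.word_fibre)
    qed
    have "?p n w * - ln (C * K) \<le> ?p n w * ln (wp n w) - ?p n w * ln (?p n w)" if w: "w \<in> word n ` Y" for w
    proof (cases "?p n w = 0")
      case False
      then have p: "?p n w > 0" by (simp add: less_le)
      have "ln (?p n w) \<le> ln (C * K * wp n w)" using le[OF w] p by simp
      also have "\<dots> = ln (C * K) + ln (wp n w)"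
        using C K1 wp_pos[OF n w] by (intro ln_mult_pos) auto
      finally have "- ln (C * K) \<le> ln (wp n w) - ln (?p n w)" by simp
      then have "?p n w * - ln (C * K) \<le> ?p n w * (ln (wp n w) - ln (?p n w))"
        using p by (intro mult_left_mono) auto
      then show ?thesis by (simp add: algebra_simps)
    qed simp
    then have "(\<Sum>w\<in>word n ` Y. ?p n w * - ln (C * K)) \<le> relEnt n N"
      unfolding relEnt_def shannon_def N.space_M sum.distrib[symmetric]
      by (intro sum_mono) (use N.space_M in auto)
    moreover have "(\<Sum>w\<in>word n ` Y. ?p n w * - ln (C * K)) = - ln (C * K)"
      using N.sum_all_words[of n] by (metis (no_types) mult_1 sum_distrib_right)
    ultimately show ?thesis by linarith
  qed
  then show ?thesis by (rule eq_of_relEnt[OF N])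
qed

section \<open>Free energy and equilibrium states\<close>

definition Gw :: "nat \<Rightarrow> nat list \<Rightarrow> real" where
  "Gw n w = G n (inv_into Y (word n) w)"

text \<open>\<open>G n\<close> depends only on the n-word, so the arbitrary representative chosen in
  \<open>Gw\<close> does not matter; integrals of \<open>ln G\<close> thereby become finite
  sums.\<close>

lemma Gw_word: "y \<in> Y \<Longrightarrow> Gw n (word n y) = G n y"
  unfolding Gw_def by (intro G_word) (auto intro: inv_into_into simp: f_inv_into_f)

lemma integral_ln_G:
  assumes "invariant_subshift k Y N"
  shows "integrable N (\<lambda>y. ln (G n y))"
    "integrable N (\<lambda>y. ln (G m ((shift ^^ n) y)))"
    "(\<integral>y. ln (G m ((shift ^^ n) y)) \<partial>N) = (\<integral>y. ln (G m y) \<partial>N)"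
    "(\<integral>y. ln (G n y) \<partial>N) = (\<Sum>w\<in>word n ` Y. ln (Gw n w) * measure N (word n -` {w} \<inter> space N))"
proof -
  interpret N: invariant_subshift k Y N by fact
  note S = N.simple_function_words
  have 1: "ln (G n y) = ln (Gw n (word n y))" if "y \<in> space N" for n y
    using that by (simp add: Gw_word N.space_M)
  have 2: "ln (G m ((shift ^^ n) y)) = ln (Gw m (word m ((shift ^^ n) y)))" if "y \<in> space N" for y
    using that by (simp add: Gw_word N.space_M funpow_in)
  show "integrable N (\<lambda>y. ln (G n y))"
    using N.integral_simple(1)[OF S[of n], of "\<lambda>w. ln (Gw n w)"]
    by (subst Bochner_Integration.integrable_cong[OF refl 1])
  show "integrable N (\<lambda>y. ln (G m ((shift ^^ n) y)))"
    using N.integral_simple(1)[OF N.simple_function_shift[OF S[of m], of n], of "\<lambda>w. ln (Gw m w)"]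
    by (subst Bochner_Integration.integrable_cong[OF refl 2])
  show "(\<integral>y. ln (G m ((shift ^^ n) y)) \<partial>N) = (\<integral>y. ln (G m y) \<partial>N)"
    using N.integral_shift[OF S[of m], of "\<lambda>w. ln (Gw m w)" n]
    by (simp only: Bochner_Integration.integral_cong[OF refl 1] Bochner_Integration.integral_cong[OF refl 2])
  have "(\<integral>y. ln (G n y) \<partial>N) = (\<integral>y. ln (Gw n (word n y)) \<partial>N)"
    by (rule Bochner_Integration.integral_cong[OF refl 1])
  also have "\<dots> = (\<Sum>w\<in>word n ` space N. ln (Gw n w) * measure N (word n -` {w} \<inter> space N))"
    by (rule N.integral_simple(2)[OF S[of n], of "\<lambda>w. ln (Gw n w)"])
  finally show "(\<integral>y. ln (G n y) \<partial>N) = (\<Sum>w\<in>word n ` Y. ln (Gw n w) * measure N (word n -` {w} \<inter> space N))"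
    by (simp only: N.space_M)
qed

text \<open>\<open>relEnt\<close> is built on masses of \<open>\<nu>\<close> and free energy on
  \<open>G\<close>. Their logarithms differ by at most \<open>ln K\<close> at every word, and so do
  the averages.\<close>

lemma integral_ln_G_relEnt:
  assumes N: "invariant_subshift k Y N" and n: "n \<ge> 1"
  shows "\<bar>relEnt n N - (shannon N (word n) + (\<integral>y. ln (G n y) \<partial>N))\<bar> \<le> ln K"
proof -
  interpret N: invariant_subshift k Y N by fact
  let ?p = "\<lambda>w. measure N (word n -` {w} \<inter> space N)"
  have close: "\<bar>ln (wp n w) - ln (Gw n w)\<bar> \<le> ln K" if w: "w \<in> word n ` Y" for w
  proof -
    obtain y where y: "y \<in> Y" "w = word n y" using w by auto
    note pos = cyl_pos[OF n y(1)] G_pos[OF n y(1)]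
    have "ln (G n y) \<le> ln (K * measure \<nu> (cyl Y n y))" using pos G_upper[OF n y(1)] by simp
    moreover have "ln (measure \<nu> (cyl Y n y)) \<le> ln (K * G n y)" using pos G_lower[OF n y(1)] by simp
    ultimately show ?thesis using pos K1 y by (simp add: ln_mult wp_word Gw_word)
  qed
  have eq: "relEnt n N - (shannon N (word n) + (\<integral>y. ln (G n y) \<partial>N)) =
      (\<Sum>w\<in>word n ` Y. ?p w * (ln (wp n w) - ln (Gw n w)))"
    unfolding relEnt_def integral_ln_G(4)[OF N]
    by (simp add: algebra_simps sum_subtractf)
  have "\<bar>relEnt n N - (shannon N (word n) + (\<integral>y. ln (G n y) \<partial>N))\<bar> \<le>
      (\<Sum>w\<in>word n ` Y. \<bar>?p w * (ln (wp n w) - ln (Gw n w))\<bar>)"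
    unfolding eq by (rule sum_abs)
  also have "\<dots> \<le> (\<Sum>w\<in>word n ` Y. ?p w * ln K)"
  proof (rule sum_mono)
    fix w assume "w \<in> word n ` Y"
    then show "\<bar>?p w * (ln (wp n w) - ln (Gw n w))\<bar> \<le> ?p w * ln K"
      unfolding abs_mult abs_of_nonneg[OF measure_nonneg] by (intro mult_left_mono close measure_nonneg)
  qed
  also have "\<dots> = ln K" using N.sum_all_words[of n] by (metis (no_types) mult_1 sum_distrib_right)
  finally show ?thesis .
qed

text \<open>Passing from \<open>G (n + m)\<close> to the product costs \<open>K ^ 4\<close>: one
  \<open>K\<close> from \<open>G_upper\<close>, one from \<open>quasi\<close> and two from
  \<open>G_lower\<close>. Adding \<open>4 * ln K\<close> to each integral makes the sequence
  genuinely subadditive, so Fekete's lemma applies.\<close>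

lemma integral_ln_G_rate:
  assumes N: "invariant_subshift k Y N"
  obtains A where "(\<lambda>n. (\<integral>y. ln (G n y) \<partial>N) / real n) \<longlonglongrightarrow> A"
    "\<And>n. n \<ge> 1 \<Longrightarrow> real n * A \<le> (\<integral>y. ln (G n y) \<partial>N) + 4 * ln K"
proof -
  interpret N: invariant_subshift k Y N by fact
  let ?a = "\<lambda>n. (\<integral>y. ln (G n y) \<partial>N)"
  note int = integral_ln_G[OF N]
  have lnK: "ln K \<ge> 0" using K1 by simp
  have sub: "?a (n + m) + 4 * ln K \<le> (?a n + 4 * ln K) + (?a m + 4 * ln K)" if n: "n \<ge> 1" and m: "m \<ge> 1" for n m
  proof -
    have "?a (n + m) \<le> (\<integral>y. ln (G n y) + ln (G m ((shift ^^ n) y)) + 4 * ln K \<partial>N)"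
    proof (rule integral_mono)
      fix y assume "y \<in> space N"
      then have y: "y \<in> Y" by (simp add: N.space_M)
      let ?z = "(shift ^^ n) y"
      have z: "?z \<in> Y" by (rule funpow_in[OF y])
      note pos = G_pos[OF n y] G_pos[OF m z]
      have "G (n + m) y \<le> K * measure \<nu> (cyl Y (n + m) y)" using n by (intro G_upper y) simp
      also have "\<dots> \<le> K * (K * measure \<nu> (cyl Y n y) * measure \<nu> (cyl Y m ?z))"
        using K1 quasi[OF n m y] by (intro mult_left_mono) auto
      also have "\<dots> = (K * K) * (measure \<nu> (cyl Y n y) * measure \<nu> (cyl Y m ?z))" by simp
      also have "\<dots> \<le> (K * K) * ((K * G n y) * (K * G m ?z))"
        using G_lower[OF n y] G_lower[OF m z] K1 pos by (intro mult_left_mono mult_mono) auto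
      also have "\<dots> = K ^ 4 * (G n y * G m ?z)" by (simp add: power4_eq_xxxx)
      finally have "ln (G (n + m) y) \<le> ln (K ^ 4 * (G n y * G m ?z))"
        using G_pos[of "n + m" y] n y by simp
      also have "\<dots> = ln (K ^ 4) + (ln (G n y) + ln (G m ?z))"
        using pos K1 by (simp add: ln_mult_pos)
      also have "ln (K ^ 4) = 4 * ln K" using K1 by (simp add: ln_realpow)
      finally show "ln (G (n + m) y) \<le> ln (G n y) + ln (G m ?z) + 4 * ln K" by simp
    qed (use int in simp_all)
    also have "\<dots> = ?a n + ?a m + 4 * ln K"
      using int N.prob_space by simp
    finally show ?thesis using lnK by simp
  qed
  have low: "- (\<bar>ln c\<bar> + ln K) * real n \<le> ?a n + 4 * ln K" if n: "n \<ge> 1" for n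
  proof -
    have "real n * ln c - ln K = (\<integral>y. real n * ln c - ln K \<partial>N)" using N.prob_space by simp
    also have "\<dots> \<le> ?a n"
    proof (rule integral_mono)
      fix y assume "y \<in> space N"
      then have y: "y \<in> Y" by (simp add: N.space_M)
      have le: "c ^ n \<le> K * G n y" using exp_lower[OF n y] G_lower[OF n y] by linarith
      have pos: "c ^ n > 0" using c0 by simp
      have "ln (c ^ n) \<le> ln (K * G n y)"
        using le pos order_less_le_trans[OF pos le] by (subst ln_le_cancel_iff)
      then show "real n * ln c - ln K \<le> ln (G n y)"
        using c0 K1 G_pos[OF n y] by (simp add: ln_realpow ln_mult_pos)
    qed (use int in simp_all)
    finally have "real n * ln c - ln K \<le> ?a n" .
    moreover have "- \<bar>ln c\<bar> * real n \<le> real n * ln c"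
      using mult_left_mono[of "- \<bar>ln c\<bar>" "ln c" "real n"] by (simp add: mult.commute)
    moreover have "ln K \<le> ln K * real n" using n lnK mult_left_mono[of 1 "real n" "ln K"] by simp
    ultimately show ?thesis using lnK by (simp add: algebra_simps)
  qed
  obtain A where A: "(\<lambda>n. (?a n + 4 * ln K) / real n) \<longlonglongrightarrow> A"
      "\<And>n. n \<ge> 1 \<Longrightarrow> real n * A \<le> ?a n + 4 * ln K"
    using fekete_subadditive[of "\<lambda>n. ?a n + 4 * ln K" "\<bar>ln c\<bar> + ln K"] sub low by blast
  have "(\<lambda>n. (?a n + 4 * ln K) / real n - 4 * ln K / real n) \<longlonglongrightarrow> A - 0"
    by (intro tendsto_diff A lim_const_over_n)
  then have "(\<lambda>n. ?a n / real n) \<longlonglongrightarrow> A" by (simp add: add_divide_distrib)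
  then show thesis using A(2) by (rule that)
qed

text \<open>Both rates are infima, the second up to \<open>4 * ln K\<close>; exchanging
  \<open>G\<close> for word masses costs another \<open>ln K\<close>. This gives a bound valid at
  every \<open>n\<close>, not only in the limit.\<close>

lemma free_energy_relEnt:
  assumes N: "invariant_subshift k Y N"
  shows "(\<lambda>n. relEnt n N / real n) \<longlonglongrightarrow> free_energy Y G N"
    "\<And>n. n \<ge> 1 \<Longrightarrow> real n * free_energy Y G N \<le> relEnt n N + 5 * ln K"
proof -
  interpret N: invariant_subshift k Y N by fact
  let ?a = "\<lambda>n. (\<integral>y. ln (G n y) \<partial>N)"
  obtain A where A: "(\<lambda>n. ?a n / real n) \<longlonglongrightarrow> A" "\<And>n. n \<ge> 1 \<Longrightarrow> real n * A \<le> ?a n + 4 * ln K"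
    using integral_ln_G_rate[OF N] by blast
  have fe: "free_energy Y G N = N.rate (\<lambda>x. x 0) + A"
    using limI[OF A(1)] by (simp add: free_energy_def N.ks_entropy_eq)
  have "(\<lambda>n. shannon N (word n) / real n + ?a n / real n) \<longlonglongrightarrow> N.rate (\<lambda>x. x 0) + A"
    by (intro tendsto_add A N.rate_LIMSEQ N.simple_function_first)
  moreover have "(\<lambda>n. relEnt n N / real n - (shannon N (word n) / real n + ?a n / real n)) \<longlonglongrightarrow> 0"
  proof (rule Lim_null_comparison)
    show "\<forall>\<^sub>F n in sequentially. norm (relEnt n N / real n - (shannon N (word n) / real n + ?a n / real n)) \<le> ln K / real n"
      using eventually_ge_at_top[of 1]
    proof eventually_elim
      case (elim n)
      have "relEnt n N / real n - (shannon N (word n) / real n + ?a n / real n) =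
          (relEnt n N - (shannon N (word n) + ?a n)) / real n"
        by (simp add: diff_divide_distrib add_divide_distrib)
      then show ?case using integral_ln_G_relEnt[OF N elim] by (simp add: abs_divide divide_right_mono)
    qed
    show "(\<lambda>n. ln K / real n) \<longlonglongrightarrow> 0" by (rule lim_const_over_n)
  qed
  ultimately show "(\<lambda>n. relEnt n N / real n) \<longlonglongrightarrow> free_energy Y G N"
    unfolding fe using tendsto_add by fastforce
  fix n :: nat assume n: "n \<ge> 1"
  show "real n * free_energy Y G N \<le> relEnt n N + 5 * ln K"
    using A(2)[OF n] N.rate_le[OF N.simple_function_first n] integral_ln_G_relEnt[OF N n]
    unfolding fe by (simp add: algebra_simps abs_le_iff)
qed

text \<open>Nonnegativity of relative entropy: \<open>relEnt_le\<close> with the trivial tilt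
  \<open>t = 1\<close>.\<close>

lemma free_energy_le: "invariant_subshift k Y N \<Longrightarrow> free_energy Y G N \<le> 0"
proof -
  assume N: "invariant_subshift k Y N"
  have "relEnt n N / real n \<le> 0" if "n \<ge> 1" for n
    using relEnt_le[OF N that, of 1 UNIV] by (simp add: divide_le_0_iff)
  then show ?thesis
    by (intro LIMSEQ_le_const2[OF free_energy_relEnt(1)[OF N]]) blast
qed

lemma invariant_subshift_nu: "invariant_subshift k Y \<nu>"
  by unfold_locales

lemma free_energy_nu: "free_energy Y G \<nu> = 0"
proof -
  have "relEnt n \<nu> = 0" for n
    by (simp add: relEnt_def shannon_def space_M sum_negf)
  then show ?thesis using LIMSEQ_unique[OF free_energy_relEnt(1)[OF invariant_subshift_nu], of 0] by simp
qed

lemma invariant_iff: "invariant_measure Y N \<longleftrightarrow> invariant_subshift k Y N"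
  using subshift by (simp add: invariant_subshift_def)

lemma equilibrium_nu: "equilibrium_state Y G \<nu>"
  unfolding equilibrium_state_def using free_energy_le free_energy_nu invariant invariant_iff by simp

text \<open>Comparison with \<open>\<nu>\<close> makes the free energy of N nonnegative, and the
  bound at finite \<open>n\<close> then becomes a lower bound for \<open>relEnt\<close> that is
  independent of \<open>n\<close>.\<close>

lemma unique_equilibrium:
  assumes "equilibrium_state Y G N"
  shows "N = \<nu>"
proof -
  have N: "invariant_subshift k Y N" using assms by (simp add: equilibrium_state_def invariant_iff)
  have "0 \<le> free_energy Y G N"
    using assms invariant free_energy_nu unfolding equilibrium_state_def by metis
  then have nn: "0 \<le> real n * free_energy Y G N" for n by simp
  have "- (5 * ln K) \<le> relEnt n N" if "n \<ge> 1" for n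
    using free_energy_relEnt(2)[OF N that] nn[of n] by linarith
  then show ?thesis by (rule eq_of_relEnt[OF N])
qed

end

section \<open>Factors of Gibbs measures\<close>

lemma word_comp: "word n (a \<circ> x) = map a (word n x)"
  by (simp add: list_eq_iff_nth_eq funpow_shift)

text \<open>The existential constants are fixed here: \<open>C\<close> for almost additivity,
  \<open>P\<close> for the pressure and \<open>C0\<close> for the Gibbs bounds.
  \<open>gibbs_unique\<close> is the source of the ergodicity of \<open>\<mu>\<close>.\<close>

locale factor_gibbs = invariant_subshift k X \<mu> for k X \<mu> +
  fixes k' :: nat and Y :: "(nat \<Rightarrow> nat) set" and a :: "nat \<Rightarrow> nat"
    and f :: "nat \<Rightarrow> (nat \<Rightarrow> nat) \<Rightarrow> real" and P C C0 :: real
  assumes subshift_Y: "subshift k' Y" and factor: "(\<lambda>x. a \<circ> x) ` X = Y"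
    and f_pos: "\<And>n x. n \<ge> 1 \<Longrightarrow> x \<in> X \<Longrightarrow> f n x > 0"
    and C_pos: "C > 0"
    and f_super: "\<And>n m x. n \<ge> 1 \<Longrightarrow> m \<ge> 1 \<Longrightarrow> x \<in> X \<Longrightarrow>
      f n x * f m ((shift ^^ n) x) \<le> exp C * f (n + m) x"
    and f_sub: "\<And>n m x. n \<ge> 1 \<Longrightarrow> m \<ge> 1 \<Longrightarrow> x \<in> X \<Longrightarrow>
      f (n + m) x \<le> exp C * (f n x * f m ((shift ^^ n) x))"
    and pressure_f: "pressure X f = ereal P"
    and C0: "C0 > 0"
    and gibbs_lower: "\<And>n x. n \<ge> 1 \<Longrightarrow> x \<in> X \<Longrightarrow>
      inverse C0 < measure \<mu> (cyl X n x) / (exp (- (real n * P)) * f n x)"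
    and gibbs_upper: "\<And>n x. n \<ge> 1 \<Longrightarrow> x \<in> X \<Longrightarrow>
      measure \<mu> (cyl X n x) / (exp (- (real n * P)) * f n x) < C0"
    and gibbs_unique: "\<And>\<mu>'. invariant_measure X \<mu>' \<Longrightarrow> gibbs X f \<mu>' \<Longrightarrow> \<mu>' = \<mu>"
begin

definition F :: "nat \<Rightarrow> (nat \<Rightarrow> nat) \<Rightarrow> real" where
  "F n x = exp (- (real n * P)) * f n x"

text \<open>A splitting involves three cylinders, each costing a factor \<open>C0\<close> for
  exchanging \<open>F\<close> and mass, and \<open>exp C\<close> comes from almost additivity. Being
  at least \<open>C0\<close>, it can be the single constant of \<open>quasi_gibbs\<close>.\<close>

definition K :: real where "K = C0 ^ 3 * exp C"

abbreviation \<nu> :: "(nat \<Rightarrow> nat) measure" where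
  "\<nu> \<equiv> distr \<mu> (restrict_space borel Y) (\<lambda>x. a \<circ> x)"

lemma F_pos: "n \<ge> 1 \<Longrightarrow> x \<in> X \<Longrightarrow> F n x > 0"
  by (simp add: F_def f_pos)

lemma cyl_less: "n \<ge> 1 \<Longrightarrow> x \<in> X \<Longrightarrow> measure \<mu> (cyl X n x) < C0 * F n x"
  using gibbs_upper[of n x] F_pos[of n x] by (simp add: F_def pos_divide_less_eq)

lemma F_less: "n \<ge> 1 \<Longrightarrow> x \<in> X \<Longrightarrow> F n x < C0 * measure \<mu> (cyl X n x)"
  using gibbs_lower[of n x] F_pos[of n x] C0
  by (simp add: F_def pos_less_divide_eq inverse_eq_divide field_simps)

lemma X_nonempty: "X \<noteq> {}"
  using subshift by (simp add: subshift_def)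

lemma C0_gt_1: "C0 > 1"
proof -
  obtain x where "x \<in> X" using X_nonempty by blast
  then have "inverse C0 < C0" using gibbs_lower[of 1 x] gibbs_upper[of 1 x] by simp
  then have "1 < C0 * C0" using C0 by (simp add: field_simps)
  then show ?thesis using C0 mult_le_one[of C0 C0] by linarith
qed

lemma C0_le_K: "C0 \<le> K"
proof -
  have "C0 * 1 \<le> C0 * (C0 * C0)" using C0_gt_1 C0 mult_mono[of 1 C0 1 C0] by (intro mult_left_mono) auto
  also have "\<dots> = C0 ^ 3 * 1" by (simp add: power3_eq_cube)
  also have "\<dots> \<le> C0 ^ 3 * exp C" using C_pos C0 by (intro mult_left_mono) auto
  finally show ?thesis by (simp add: K_def)
qed

lemma K_ge_1: "K \<ge> 1"
  using C0_le_K C0_gt_1 by linarith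

lemma mu_cyl_pos: "n \<ge> 1 \<Longrightarrow> x \<in> X \<Longrightarrow> measure \<mu> (cyl X n x) > 0"
  using less_trans[OF F_pos F_less, of n x] C0 by (simp add: zero_less_mult_iff)

lemma mu_quasi:
  assumes n: "n \<ge> 1" and m: "m \<ge> 1" and x: "x \<in> X"
  shows "measure \<mu> (cyl X (n + m) x) \<le> K * (measure \<mu> (cyl X n x) * measure \<mu> (cyl X m ((shift ^^ n) x)))"
    and "measure \<mu> (cyl X n x) * measure \<mu> (cyl X m ((shift ^^ n) x)) \<le> K * measure \<mu> (cyl X (n + m) x)"
proof -
  let ?z = "(shift ^^ n) x"
  have z: "?z \<in> X" by (rule funpow_in[OF x])
  have nm: "n + m \<ge> 1" using n by simp
  have e: "exp (- (real (n + m) * P)) = exp (- (real n * P)) * exp (- (real m * P))"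
    by (simp add: algebra_simps flip: exp_add)
  have e0: "exp (- (real n * P)) * exp (- (real m * P)) \<ge> 0" by simp
  have sub: "F (n + m) x \<le> exp C * (F n x * F m ?z)"
    using mult_left_mono[OF f_sub[OF n m x] e0] unfolding F_def e by (simp only: mult_ac)
  have super: "F n x * F m ?z \<le> exp C * F (n + m) x"
    using mult_left_mono[OF f_super[OF n m x] e0] unfolding F_def e by (simp only: mult_ac)
  note p = F_pos[OF n x] F_pos[OF m z] F_pos[OF nm x]
  note u = cyl_less[OF n x, THEN less_imp_le] cyl_less[OF m z, THEN less_imp_le] cyl_less[OF nm x, THEN less_imp_le]
  note l = F_less[OF n x, THEN less_imp_le] F_less[OF m z, THEN less_imp_le] F_less[OF nm x, THEN less_imp_le]
  have "measure \<mu> (cyl X (n + m) x) \<le> C0 * (exp C * (F n x * F m ?z))"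
    using u(3) mult_left_mono[OF sub, of C0] C0 by linarith
  also have "\<dots> \<le> C0 * (exp C * ((C0 * measure \<mu> (cyl X n x)) * (C0 * measure \<mu> (cyl X m ?z))))"
    using C0 p l by (intro mult_left_mono mult_mono) auto
  also have "\<dots> = K * (measure \<mu> (cyl X n x) * measure \<mu> (cyl X m ?z))"
    by (simp add: K_def power3_eq_cube mult_ac)
  finally show "measure \<mu> (cyl X (n + m) x) \<le> K * (measure \<mu> (cyl X n x) * measure \<mu> (cyl X m ?z))" .
  have "measure \<mu> (cyl X n x) * measure \<mu> (cyl X m ?z) \<le> (C0 * F n x) * (C0 * F m ?z)"
    using C0 p u by (intro mult_mono) auto
  also have "\<dots> = (C0 * C0) * (F n x * F m ?z)" by simp
  also have "\<dots> \<le> (C0 * C0) * (exp C * F (n + m) x)" using C0 super by (intro mult_left_mono) auto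
  also have "\<dots> \<le> (C0 * C0) * (exp C * (C0 * measure \<mu> (cyl X (n + m) x)))"
    using C0 l by (intro mult_left_mono) auto
  also have "\<dots> = K * measure \<mu> (cyl X (n + m) x)" by (simp add: K_def power3_eq_cube mult_ac)
  finally show "measure \<mu> (cyl X n x) * measure \<mu> (cyl X m ?z) \<le> K * measure \<mu> (cyl X (n + m) x)" .
qed

text \<open>Finitely many letters give a positive minimum \<open>m\<close> over the 1-cylinders, and
  by the lower half of quasi-multiplicativity each further letter multiplies the mass by at least
  \<open>m / K\<close>.\<close>

lemma mu_exp_lower:
  obtains c where "c > 0" "\<And>n x. n \<ge> 1 \<Longrightarrow> x \<in> X \<Longrightarrow> c ^ n \<le> measure \<mu> (cyl X n x)"
proof -
  let ?p = "\<lambda>w. measure \<mu> (word 1 -` {w} \<inter> space \<mu>)"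
  define m where "m = Min (?p ` word 1 ` X)"
  have fin: "finite (?p ` word 1 ` X)" by (intro finite_imageI[OF finite_words(1)[OF subshift]])
  have "m \<in> ?p ` word 1 ` X" unfolding m_def using fin X_nonempty by (intro Min_in) auto
  then obtain x where "x \<in> X" "m = ?p (word 1 x)" by blast
  then have m0: "m > 0" using mu_cyl_pos[of 1 x] word_fibre[of x 1] by simp
  have m_le: "m \<le> measure \<mu> (cyl X 1 x)" if "x \<in> X" for x
  proof -
    have "m \<le> ?p (word 1 x)" unfolding m_def using fin that by (intro Min_le) auto
    then show ?thesis using word_fibre[OF that, of 1] by simp
  qed
  define c where "c = m / K"
  have c0: "c > 0" using m0 K_ge_1 by (simp add: c_def)
  have cm: "c \<le> m" using m0 K_ge_1 by (simp add: c_def field_simps)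
  have "c ^ n \<le> measure \<mu> (cyl X n x)" if n: "n \<ge> 1" and x: "x \<in> X" for n x
    using n
  proof (induction n rule: dec_induct)
    case base
    show ?case using cm m_le[OF x] by simp
  next
    case (step n)
    have "c ^ Suc n = c ^ n * m / K" by (simp add: c_def)
    also have "\<dots> \<le> measure \<mu> (cyl X n x) * measure \<mu> (cyl X 1 ((shift ^^ n) x)) / K"
      using step.IH m_le[OF funpow_in[OF x], of n] m0 K_ge_1
      by (intro divide_right_mono mult_mono) auto
    also have "\<dots> \<le> measure \<mu> (cyl X (n + 1) x)"
      using mu_quasi(2)[OF step.hyps(1) _ x, of 1] K_ge_1 by (simp add: pos_divide_le_eq mult.commute)
    finally show ?case by simp
  qed
  then show thesis by (rule that[OF c0])
qed

section \<open>The factor measure and its cylinders\<close>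

lemma pi_in: "x \<in> X \<Longrightarrow> a \<circ> x \<in> Y"
  using factor by blast

lemma pi_measurable: "(\<lambda>x. a \<circ> x) \<in> measurable \<mu> (restrict_space borel Y)"
proof (rule measurable_seqI)
  show "(\<lambda>x. a \<circ> x) \<in> space \<mu> \<rightarrow> Y" by (simp add: space_M pi_in)
  fix i
  have "measurable \<mu> (count_space UNIV) = measurable (restrict_space borel X) (count_space (UNIV :: nat set))"
    by (rule measurable_cong_sets[OF sets_M refl])
  then have "(\<lambda>x. x i) \<in> measurable \<mu> (count_space UNIV)"
    using borel_measurable_coordinate[of i X] by simp
  from measurable_compose[OF this, of a "count_space UNIV"]
  show "(\<lambda>x. (a \<circ> x) i) \<in> measurable \<mu> (count_space UNIV)" by simp
qed

lemma pi_events: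
  assumes "A \<in> sets (restrict_space borel Y)"
  shows "{x \<in> X. a \<circ> x \<in> A} \<in> events"
proof -
  have "(\<lambda>x. a \<circ> x) -` A \<inter> space \<mu> = {x \<in> X. a \<circ> x \<in> A}" by (auto simp: space_M)
  then show ?thesis using measurable_sets[OF pi_measurable assms] by simp
qed

lemma emeasure_nu:
  assumes "A \<in> sets (restrict_space borel Y)"
  shows "emeasure \<nu> A = emeasure \<mu> {x \<in> X. a \<circ> x \<in> A}"
proof -
  have "(\<lambda>x. a \<circ> x) -` A \<inter> space \<mu> = {x \<in> X. a \<circ> x \<in> A}" by (auto simp: space_M)
  then show ?thesis using emeasure_distr[OF pi_measurable assms] by simp
qed

lemma measure_nu:
  assumes "A \<in> sets (restrict_space borel Y)"
  shows "measure \<nu> A = measure \<mu> {x \<in> X. a \<circ> x \<in> A}"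
  using emeasure_nu[OF assms] by (simp only: measure_def)

lemma shift_measurable_Y: "shift \<in> measurable (restrict_space borel Y) (restrict_space borel Y)"
proof (rule measurable_seqI)
  show "shift \<in> space (restrict_space borel Y) \<rightarrow> Y"
    using subshift_funpow_in[OF subshift_Y, of _ 1] by (auto simp: space_restrict_space)
  show "(\<lambda>x. shift x i) \<in> measurable (restrict_space borel Y) (count_space UNIV)" for i
    using borel_measurable_coordinate[of "Suc i" Y] by (simp add: shift_def)
qed

lemma shift_comp: "shift (a \<circ> x) = a \<circ> shift x"
  by (simp add: shift_def fun_eq_iff)

lemma shift_preimage_Y:
  assumes "A \<in> sets (restrict_space borel Y)"
  shows "shift -` A \<inter> Y \<in> sets (restrict_space borel Y)"
  using measurable_sets[OF shift_measurable_Y assms] by (simp add: space_restrict_space)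

lemma invariant_nu: "invariant_measure Y \<nu>"
  unfolding invariant_measure_def prob_on_def
proof (intro conjI ballI)
  show "prob_space \<nu>" by (rule prob_space_distr[OF pi_measurable])
  show "sets \<nu> = sets (restrict_space borel Y)" by simp
  fix A assume "A \<in> sets \<nu>"
  then have A: "A \<in> sets (restrict_space borel Y)" by simp
  have "{x \<in> X. a \<circ> x \<in> shift -` A \<inter> Y} = shift -` {x \<in> X. a \<circ> x \<in> A} \<inter> X"
    using shift_in pi_in by (auto simp: shift_comp)
  moreover have "emeasure \<mu> (shift -` {x \<in> X. a \<circ> x \<in> A} \<inter> X) = emeasure \<mu> {x \<in> X. a \<circ> x \<in> A}"
    using invariant pi_events[OF A] unfolding invariant_measure_def by blast
  ultimately show "emeasure \<nu> (shift -` A \<inter> Y) = emeasure \<nu> A"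
    by (simp only: emeasure_nu[OF A] emeasure_nu[OF shift_preimage_Y[OF A]])
qed

lemma cyl_Y_sets: "cyl Y n y \<in> sets (restrict_space borel Y)"
proof -
  interpret Y: invariant_subshift k' Y \<nu>
    by (intro invariant_subshift.intro subshift_Y invariant_nu)
  show ?thesis using Y.cyl_events[of n y] by simp
qed

definition lifts :: "nat \<Rightarrow> (nat \<Rightarrow> nat) \<Rightarrow> nat list set" where
  "lifts n y = word n ` X \<inter> {w. map a w = word n y}"

lemma nu_cyl: "measure \<nu> (cyl Y n y) = (\<Sum>w\<in>lifts n y. measure \<mu> (word n -` {w} \<inter> space \<mu>))"
proof -
  have "{x \<in> X. a \<circ> x \<in> cyl Y n y} = {x \<in> X. word n x \<in> {w. map a w = word n y}}"
    by (auto simp: cyl_eq_word pi_in word_comp)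
  then show ?thesis using sum_words[of n] by (simp only: measure_nu[OF cyl_Y_sets] lifts_def)
qed

lemma finite_lifts: "finite (lifts n y)"
  unfolding lifts_def using finite_words(1)[OF subshift, of n] by blast

text \<open>Cutting a lift after \<open>n\<close> letters gives a lift of each part, and the two
  parts determine it. The inclusion into pairs may be strict, which accounts for the one-sided
  bound.\<close>

lemma nu_quasi:
  assumes n: "n \<ge> 1" and m: "m \<ge> 1"
  shows "measure \<nu> (cyl Y (n + m) y) \<le> K * measure \<nu> (cyl Y n y) * measure \<nu> (cyl Y m ((shift ^^ n) y))"
proof -
  let ?p = "\<lambda>n w. measure \<mu> (word n -` {w} \<inter> space \<mu>)"
  let ?s = "\<lambda>w. (take n w, drop n w)"
  have inj: "inj_on ?s (lifts (n + m) y)"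
    by (rule inj_onI) (metis append_take_drop_id prod.inject)
  have img: "?s ` lifts (n + m) y \<subseteq> lifts n y \<times> lifts m ((shift ^^ n) y)"
  proof (rule image_subsetI)
    fix w assume w: "w \<in> lifts (n + m) y"
    then obtain x where x: "x \<in> X" "w = word (n + m) x" and mw: "map a w = word (n + m) y"
      unfolding lifts_def by blast
    have s: "take n w = word n x" "drop n w = word m ((shift ^^ n) x)"
      unfolding x(2) block_add by simp_all
    have "map a (take n w) = word n y" "map a (drop n w) = word m ((shift ^^ n) y)"
      using mw unfolding block_add by (simp_all add: take_map[symmetric] drop_map[symmetric])
    then show "?s w \<in> lifts n y \<times> lifts m ((shift ^^ n) y)"
      using s x(1) funpow_in[OF x(1), of n] unfolding lifts_def by auto
  qed
  have "measure \<nu> (cyl Y (n + m) y) = (\<Sum>w\<in>lifts (n + m) y. ?p (n + m) w)" by (rule nu_cyl)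
  also have "\<dots> \<le> (\<Sum>w\<in>lifts (n + m) y. K * (?p n (take n w) * ?p m (drop n w)))"
  proof (rule sum_mono)
    fix w assume "w \<in> lifts (n + m) y"
    then obtain x where x: "x \<in> X" "w = word (n + m) x" unfolding lifts_def by blast
    have s: "take n w = word n x" "drop n w = word m ((shift ^^ n) x)"
      unfolding x(2) block_add by simp_all
    show "?p (n + m) w \<le> K * (?p n (take n w) * ?p m (drop n w))"
      using mu_quasi(1)[OF n m x(1)]
      unfolding s unfolding x(2) word_fibre[OF x(1)] word_fibre[OF funpow_in[OF x(1)]] .
  qed
  also have "\<dots> = (\<Sum>q\<in>?s ` lifts (n + m) y. K * (?p n (fst q) * ?p m (snd q)))"
    using inj by (simp add: sum.reindex)
  also have "\<dots> \<le> (\<Sum>q\<in>lifts n y \<times> lifts m ((shift ^^ n) y). K * (?p n (fst q) * ?p m (snd q)))"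
    using img finite_lifts K_ge_1 by (intro sum_mono2) auto
  also have "\<dots> = K * ((\<Sum>u\<in>lifts n y. ?p n u) * (\<Sum>v\<in>lifts m ((shift ^^ n) y). ?p m v))"
    unfolding sum_product sum.cartesian_product case_prod_unfold by (rule sum_distrib_left[symmetric])
  finally show ?thesis unfolding nu_cyl[of n] nu_cyl[of m] by (simp only: mult.assoc)
qed

lemma nu_cyl_ge:
  assumes "x \<in> X" shows "measure \<mu> (cyl X n x) \<le> measure \<nu> (cyl Y n (a \<circ> x))"
proof -
  have "cyl X n x \<subseteq> {z \<in> X. a \<circ> z \<in> cyl Y n (a \<circ> x)}"
    by (auto simp: cyl_eq_word word_comp pi_in)
  then show ?thesis
    unfolding measure_nu[OF cyl_Y_sets] by (intro finite_measure_mono pi_events cyl_Y_sets)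
qed

lemma cover_cyl_iff:
  assumes "x \<in> X"
  shows "(\<lambda>z. a \<circ> z) ` cyl X n x \<subseteq> cyl Y n y \<longleftrightarrow> word n x \<in> lifts n y"
proof
  assume "(\<lambda>z. a \<circ> z) ` cyl X n x \<subseteq> cyl Y n y"
  moreover have "x \<in> cyl X n x" using assms by (simp add: cyl_def)
  ultimately have "a \<circ> x \<in> cyl Y n y" by blast
  then show "word n x \<in> lifts n y" using assms by (simp add: lifts_def cyl_eq_word word_comp)
next
  assume "word n x \<in> lifts n y"
  then have "map a (word n x) = word n y" by (simp add: lifts_def)
  then show "(\<lambda>z. a \<circ> z) ` cyl X n x \<subseteq> cyl Y n y"
    by (auto simp: cyl_eq_word word_comp pi_in)
qed

text \<open>Whether a cylinder of X lies over the cylinder of \<open>y\<close> depends only on its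
  word. Admissible sets are thus systems of representatives of the lifts, and sums over them can be
  indexed by words.\<close>

lemma En_set_iff:
  "En_set X Y a n y E \<longleftrightarrow> E \<subseteq> X \<and> inj_on (word n) E \<and> word n ` E = lifts n y"
proof
  assume E: "En_set X Y a n y E"
  have EX: "E \<subseteq> X" using E by (simp add: En_set_def)
  have sub: "word n x \<in> lifts n y" if "x \<in> E" for x
    using E that EX cover_cyl_iff[of x n y] unfolding En_set_def by blast
  have card: "card (E \<inter> cyl X n x) = 1" if "x \<in> X" "word n x \<in> lifts n y" for x
    using E that cover_cyl_iff[of x n y] unfolding En_set_def by blast
  have "inj_on (word n) E"
  proof (rule inj_onI)
    fix x z assume xz: "x \<in> E" "z \<in> E" "word n x = word n z"
    then have "x \<in> E \<inter> cyl X n x" "z \<in> E \<inter> cyl X n x" using EX by (auto simp: cyl_eq_word)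
    moreover obtain u where "E \<inter> cyl X n x = {u}"
      using card[of x] sub[of x] xz EX by (auto simp: card_1_singleton_iff)
    ultimately show "x = z" by auto
  qed
  moreover have "lifts n y \<subseteq> word n ` E"
  proof
    fix w assume w: "w \<in> lifts n y"
    then obtain x where x: "x \<in> X" "w = word n x" unfolding lifts_def by blast
    then obtain u where "E \<inter> cyl X n x = {u}"
      using card[of x] w by (auto simp: card_1_singleton_iff)
    then have "u \<in> E" "word n u = w" using x by (auto simp: cyl_eq_word)
    then show "w \<in> word n ` E" by blast
  qed
  ultimately show "E \<subseteq> X \<and> inj_on (word n) E \<and> word n ` E = lifts n y"
    using EX sub by blast
next
  assume E: "E \<subseteq> X \<and> inj_on (word n) E \<and> word n ` E = lifts n y"
  show "En_set X Y a n y E"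
    unfolding En_set_def
  proof (intro conjI ballI impI)
    show "E \<subseteq> X" using E by blast
    show "(\<lambda>z. a \<circ> z) ` cyl X n x \<subseteq> cyl Y n y" if "x \<in> E" for x
      using that E cover_cyl_iff[of x n y] by blast
    show "card (E \<inter> cyl X n x) = 1" if x: "x \<in> X" and c: "(\<lambda>z. a \<circ> z) ` cyl X n x \<subseteq> cyl Y n y" for x
    proof -
      have "word n x \<in> word n ` E" using x c E cover_cyl_iff[of x n y] by blast
      then obtain u where u: "u \<in> E" "word n u = word n x" by force
      have "E \<inter> cyl X n x = {u}"
      proof (intro equalityI subsetI)
        fix z assume "z \<in> E \<inter> cyl X n x"
        then have "z \<in> E" "word n z = word n u" using u by (auto simp: cyl_eq_word)
        then show "z \<in> {u}" using E u(1) by (auto dest: inj_onD)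
      next
        fix z assume "z \<in> {u}"
        then show "z \<in> E \<inter> cyl X n x" using u E by (auto simp: cyl_eq_word)
      qed
      then show ?thesis by simp
    qed
  qed
qed

section \<open>The factor potential, ergodicity and transfer to Y\<close>

abbreviation Gt :: "nat \<Rightarrow> (nat \<Rightarrow> nat) \<Rightarrow> real" where
  "Gt \<equiv> gtilde X Y a f"

text \<open>For every admissible \<open>E\<close> the cylinder masses at its points add up to the
  same number, the \<open>\<nu>\<close>-mass of the cylinder of \<open>y\<close>. The Gibbs bounds
  carry this over to the sums of \<open>f\<close> and to their supremum.\<close>

lemma Gt_bounds:
  assumes n: "n \<ge> 1"
  shows "Gt n y \<le> C0 * measure \<nu> (cyl Y n y)" "measure \<nu> (cyl Y n y) \<le> C0 * Gt n y"
proof -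
  let ?e = "exp (- (real n * P))"
  let ?S = "{(\<Sum>x\<in>E. f n x) | E. En_set X Y a n y E}"
  have sum_nu: "(\<Sum>x\<in>E. measure \<mu> (cyl X n x)) = measure \<nu> (cyl Y n y)" if "En_set X Y a n y E" for E
  proof -
    have E: "E \<subseteq> X" "inj_on (word n) E" "word n ` E = lifts n y" using that by (auto simp: En_set_iff)
    have "(\<Sum>x\<in>E. measure \<mu> (cyl X n x)) = (\<Sum>x\<in>E. measure \<mu> (word n -` {word n x} \<inter> space \<mu>))"
      using E(1) by (intro sum.cong refl) (metis subsetD word_fibre)
    also have "\<dots> = (\<Sum>w\<in>lifts n y. measure \<mu> (word n -` {w} \<inter> space \<mu>))"
      unfolding E(3)[symmetric] using E(2) by (simp add: sum.reindex)
    finally show ?thesis by (simp add: nu_cyl)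
  qed
  have up: "s * ?e \<le> C0 * measure \<nu> (cyl Y n y)" if s: "s \<in> ?S" for s
  proof -
    obtain E where E: "En_set X Y a n y E" "s = (\<Sum>x\<in>E. f n x)" using s by blast
    then have EX: "E \<subseteq> X" by (simp add: En_set_def)
    have "s * ?e = (\<Sum>x\<in>E. F n x)" unfolding E(2) F_def sum_distrib_right by (simp only: mult.commute)
    also have "\<dots> \<le> (\<Sum>x\<in>E. C0 * measure \<mu> (cyl X n x))"
      using EX F_less[OF n] by (intro sum_mono less_imp_le) blast
    finally show ?thesis by (simp add: sum_nu[OF E(1)] flip: sum_distrib_left)
  qed
  have Gt: "Gt n y = Sup ?S * ?e" by (simp add: gtilde_def gsum_def pressure_f)
  \<comment> \<open>An explicit admissible set: it makes the set of sums nonempty, as the real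
    supremum requires, and supplies the lower bound.\<close>
  define E where "E = inv_into X (word n) ` lifts n y"
  have sub: "lifts n y \<subseteq> word n ` X" by (auto simp: lifts_def)
  have "E \<subseteq> X" unfolding E_def using sub by (auto intro: inv_into_into)
  moreover have "word n ` E = lifts n y"
    unfolding E_def image_image using sub by (simp add: f_inv_into_f subset_iff)
  moreover have "inj_on (word n) E"
    unfolding E_def using sub by (intro inj_onI) (auto simp: f_inv_into_f subset_iff)
  ultimately have E: "En_set X Y a n y E" by (simp add: En_set_iff)
  have inS: "(\<Sum>x\<in>E. f n x) \<in> ?S" using E by blast
  have up': "s \<le> C0 * measure \<nu> (cyl Y n y) / ?e" if "s \<in> ?S" for s
    using up[OF that] by (subst pos_le_divide_eq) simp_all
  have bdd: "bdd_above ?S" using up' by (rule bdd_aboveI)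
  have "Sup ?S \<le> C0 * measure \<nu> (cyl Y n y) / ?e" using inS up' by (intro cSup_least) auto
  then show "Gt n y \<le> C0 * measure \<nu> (cyl Y n y)" unfolding Gt by (subst (asm) pos_le_divide_eq) simp_all
  have "measure \<nu> (cyl Y n y) = (\<Sum>x\<in>E. measure \<mu> (cyl X n x))" by (rule sum_nu[OF E, symmetric])
  also have "\<dots> \<le> (\<Sum>x\<in>E. C0 * F n x)"
    using \<open>E \<subseteq> X\<close> cyl_less[OF n] by (intro sum_mono less_imp_le) blast
  also have "\<dots> = C0 * ((\<Sum>x\<in>E. f n x) * ?e)"
    by (simp add: F_def sum_distrib_left sum_distrib_right mult_ac)
  also have "\<dots> \<le> C0 * (Sup ?S * ?e)"
    using C0 inS bdd by (intro mult_left_mono mult_right_mono cSup_upper) auto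
  finally show "measure \<nu> (cyl Y n y) \<le> C0 * Gt n y" unfolding Gt .
qed

text \<open>Reweighting \<mu> on an invariant set of intermediate measure and on its complement by different
  constants gives a second invariant Gibbs measure.\<close>

lemma ergodic_mu:
  assumes B: "B \<in> events" and null: "prob (B - shift -` B) = 0" "prob (shift -` B \<inter> X - B) = 0"
  shows "prob B = 0 \<or> prob B = 1"
proof (rule ccontr)
  assume "\<not> (prob B = 0 \<or> prob B = 1)"
  then have b: "0 < prob B" "prob B < 1" using prob_le_1[of B] by (auto simp: less_le)
  \<comment> \<open>Solves \<open>prob B / 2 + c * (1 - prob B) = 1\<close>, so that density
    \<open>1/2\<close> on \<open>B\<close> and \<open>c\<close> off \<open>B\<close> has total mass
    1.\<close>
  define c where "c = (1 - prob B / 2) / (1 - prob B)"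
  have c1: "c \<ge> 1" using b by (simp add: c_def field_simps)
  have BX: "B \<subseteq> X" using sets.sets_into_space[OF B] by (simp add: space_M)
  define M' where "M' = density \<mu> (\<lambda>x. if x \<in> B then ennreal (1/2) else ennreal c)"
  have sM': "sets M' = events" by (simp add: M'_def)
  have em: "emeasure M' S = ennreal (1/2 * prob (S \<inter> B) + c * prob (S - B))" if S[measurable]: "S \<in> events" for S
  proof -
    note B[measurable]
    have "emeasure M' S = (\<integral>\<^sup>+x. (if x \<in> B then ennreal (1/2) else ennreal c) * indicator S x \<partial>\<mu>)"
      unfolding M'_def by (intro emeasure_density) auto
    also have "\<dots> = (\<integral>\<^sup>+x. ennreal (1/2) * indicator (S \<inter> B) x + ennreal c * indicator (S - B) x \<partial>\<mu>)"
      by (intro nn_integral_cong) (auto simp: indicator_def)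
    also have "\<dots> = (\<integral>\<^sup>+x. ennreal (1/2) * indicator (S \<inter> B) x \<partial>\<mu>) + (\<integral>\<^sup>+x. ennreal c * indicator (S - B) x \<partial>\<mu>)"
      by (intro nn_integral_add) auto
    also have "\<dots> = ennreal (1/2) * emeasure \<mu> (S \<inter> B) + ennreal c * emeasure \<mu> (S - B)"
      using B S by (simp add: nn_integral_cmult_indicator)
    also have "\<dots> = ennreal (1/2 * prob (S \<inter> B)) + ennreal (c * prob (S - B))"
      unfolding emeasure_eq_measure using c1 by (intro arg_cong2[where f = "(+)"] ennreal_mult[symmetric]) auto
    also have "\<dots> = ennreal (1/2 * prob (S \<inter> B) + c * prob (S - B))"
      using c1 by (intro ennreal_plus[symmetric]) auto
    finally show ?thesis .
  qed
  have meas: "measure M' S = 1/2 * prob (S \<inter> B) + c * prob (S - B)" if "S \<in> events" for S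
    unfolding measure_def[of M'] em[OF that] using c1 by (intro enn2real_ennreal) simp
  have split: "prob S = prob (S \<inter> B) + prob (S - B)" if "S \<in> events" for S
    using finite_measure_Diff'[OF that B] by simp
  have "emeasure M' X = 1"
  proof -
    have "X \<inter> B = B" using BX by blast
    moreover have "prob (X - B) = 1 - prob B" using prob_compl[OF B] by (simp add: space_M)
    moreover have "1/2 * prob B + c * (1 - prob B) = 1" using b by (simp add: c_def)
    ultimately show ?thesis unfolding em[OF X_events] by (simp only: ennreal_1)
  qed
  then have "prob_space M'" by (intro prob_spaceI) (simp add: M'_def space_M)
  have inv: "emeasure M' (shift -` S \<inter> X) = emeasure M' S" if S: "S \<in> events" for S
  proof -
    have pre: "shift -` A \<inter> X \<in> events \<and> prob (shift -` A \<inter> X) = prob A" if A: "A \<in> events" for A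
    proof -
      have "shift -` A \<inter> X = {x \<in> X. (shift ^^ 1) x \<in> A}" by auto
      then show ?thesis using shift_preimage[OF A, of 1] by (simp only:)
    qed
    let ?S = "shift -` S \<inter> X" and ?B = "shift -` B \<inter> X"
    have SE: "?S \<in> events" "?B \<in> events" using pre[OF S] pre[OF B] by auto
    \<comment> \<open>\<open>B\<close> and its preimage differ by null sets, so the preimage of
      \<open>S\<close> meets both in equal mass. Its intersection with the preimage of
      \<open>B\<close> is the preimage of \<open>S \<inter> B\<close>, to which the invariance of
      \<open>\<mu>\<close> applies.\<close>
    have nB: "prob (B - ?B) = 0" using null(1) BX by (metis Diff_Int Diff_eq_empty_iff Un_empty_right)
    have "prob (?S \<inter> B) \<le> prob (?S \<inter> ?B \<union> (B - ?B))"
      using SE B by (intro finite_measure_mono) auto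
    also have "\<dots> \<le> prob (?S \<inter> ?B) + prob (B - ?B)" using SE B by (intro measure_Un_le) auto
    finally have 1: "prob (?S \<inter> B) \<le> prob (?S \<inter> ?B)" using nB by simp
    have "prob (?S \<inter> ?B) \<le> prob (?S \<inter> B \<union> (?B - B))"
      using SE B by (intro finite_measure_mono) auto
    also have "\<dots> \<le> prob (?S \<inter> B) + prob (?B - B)" using SE B by (intro measure_Un_le) auto
    finally have 2: "prob (?S \<inter> ?B) \<le> prob (?S \<inter> B)" using null(2) by simp
    have "?S \<inter> ?B = shift -` (S \<inter> B) \<inter> X" by blast
    then have "prob (?S \<inter> ?B) = prob (S \<inter> B)" using pre[of "S \<inter> B"] S B by simp
    then have eq: "prob (?S \<inter> B) = prob (S \<inter> B)" using 1 2 by simp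
    have "prob (?S - B) = prob (S - B)" using split[OF SE(1)] split[OF S] eq pre[OF S] by simp
    then show ?thesis using em[OF SE(1)] em[OF S] eq by simp
  qed
  have invM': "invariant_measure X M'"
    unfolding invariant_measure_def prob_on_def using \<open>prob_space M'\<close> inv sM' sets_M by simp
  have "gibbs X f M'"
    unfolding gibbs_def
  proof (intro exI conjI allI impI ballI)
    show "pressure X f = ereal P" by (rule pressure_f)
    \<comment> \<open>The new density lies between \<open>1/2\<close> and \<open>c\<close>;
      \<open>c + 2\<close> covers the loss of 2 below and of \<open>c\<close> above.\<close>
    show "(c + 2) * C0 > 0" using c1 C0 by simp
    fix n :: nat and x assume n: "n \<ge> 1" and x: "x \<in> X"
    let ?c = "cyl X n x"
    have cE: "?c \<in> events" by (rule cyl_events)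
    have lo: "prob ?c / 2 \<le> measure M' ?c"
      unfolding meas[OF cE] split[OF cE] using c1 mult_right_mono[of "1/2" c "prob (?c - B)"] by simp
    have hi: "measure M' ?c \<le> c * prob ?c"
      unfolding meas[OF cE] split[OF cE] using c1 mult_right_mono[of "1/2" c "prob (?c \<inter> B)"]
      by (simp add: algebra_simps)
    note p = F_pos[OF n x] mu_cyl_pos[OF n x]
    have "F n x < C0 * prob ?c" by (rule F_less[OF n x])
    also have "\<dots> \<le> C0 * (2 * measure M' ?c)" using lo C0 by simp
    also have "\<dots> \<le> (c + 2) * C0 * measure M' ?c"
      using c1 C0 by (simp add: algebra_simps)
    finally have "F n x < (c + 2) * C0 * measure M' ?c" .
    then have "inverse ((c + 2) * C0) < measure M' ?c / F n x"
      using p c1 C0 by (simp add: pos_less_divide_eq pos_divide_less_eq inverse_eq_divide mult_ac)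
    then show "inverse ((c + 2) * C0) < measure M' ?c / (exp (- (real n * P)) * f n x)"
      by (simp only: F_def)
    have "measure M' ?c < c * (C0 * F n x)"
      using hi mult_strict_left_mono[OF cyl_less[OF n x], of c] c1 by linarith
    also have "\<dots> \<le> (c + 2) * C0 * F n x" using c1 C0 p by (simp add: algebra_simps)
    finally have "measure M' ?c / F n x < (c + 2) * C0" using p by (simp add: pos_divide_less_eq)
    then show "measure M' ?c / (exp (- (real n * P)) * f n x) < (c + 2) * C0"
      by (simp only: F_def)
  qed
  then have "M' = \<mu>" by (rule gibbs_unique[OF invM'])
  then have "prob B = 1/2 * prob B" using meas[OF B] by simp
  then show False using b by simp
qed

text \<open>Ergodicity passes to factors: the preimage of \<open>A\<close> under the factor map is
  invariant up to \<open>\<mu>\<close>-null sets, because that map commutes with the shift.\<close>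

lemma ergodic_nu:
  assumes "A \<in> sets \<nu>" and null: "measure \<nu> (A - shift -` A) = 0" "measure \<nu> (shift -` A \<inter> Y - A) = 0"
  shows "measure \<nu> A = 0 \<or> measure \<nu> A = 1"
proof -
  have A: "A \<in> sets (restrict_space borel Y)" using assms(1) by simp
  have AY: "A \<subseteq> Y" using sets.sets_into_space[OF A] by (simp add: space_restrict_space)
  define B where "B = {x \<in> X. a \<circ> x \<in> A}"
  have 1: "A - shift -` A \<in> sets (restrict_space borel Y)"
  proof -
    have "A - shift -` A = A - (shift -` A \<inter> Y)" using AY by blast
    then show ?thesis using A shift_preimage_Y[OF A] by (metis sets.Diff)
  qed
  have 2: "shift -` A \<inter> Y - A \<in> sets (restrict_space borel Y)"
    using A shift_preimage_Y[OF A] by blast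
  have "{x \<in> X. a \<circ> x \<in> A - shift -` A} = B - shift -` B"
    using shift_in by (auto simp: B_def shift_comp)
  then have n1: "prob (B - shift -` B) = 0" using null(1) measure_nu[OF 1] by simp
  have "{x \<in> X. a \<circ> x \<in> shift -` A \<inter> Y - A} = shift -` B \<inter> X - B"
    using shift_in pi_in by (auto simp: B_def shift_comp)
  then have n2: "prob (shift -` B \<inter> X - B) = 0" using null(2) measure_nu[OF 2] by simp
  have "B \<in> events" unfolding B_def by (rule pi_events[OF A])
  from ergodic_mu[OF this n1 n2] show ?thesis using measure_nu[OF A] by (simp add: B_def)
qed

lemma quasi_gibbs_nu: "\<exists>c. quasi_gibbs k' Y \<nu> Gt K c"
proof -
  obtain c where c: "c > 0" "\<And>n x. n \<ge> 1 \<Longrightarrow> x \<in> X \<Longrightarrow> c ^ n \<le> measure \<mu> (cyl X n x)"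
    using mu_exp_lower by blast
  have "quasi_gibbs k' Y \<nu> Gt K c"
  proof (intro quasi_gibbs.intro invariant_subshift.intro quasi_gibbs_axioms.intro)
    show "subshift k' Y" by (rule subshift_Y)
    show "invariant_measure Y \<nu>" by (rule invariant_nu)
    show "K \<ge> 1" by (rule K_ge_1)
    show "c > 0" by (rule c(1))
    show "Gt n x = Gt n y" if "word n x = word n y" for n x y
    proof -
      have "cyl Y n x = cyl Y n y" using that by (simp add: cyl_eq_word)
      then show ?thesis by (simp only: gtilde_def gsum_def En_set_def)
    qed
    fix n :: nat and y assume n: "n \<ge> 1" and y: "y \<in> Y"
    have "C0 * measure \<nu> (cyl Y n y) \<le> K * measure \<nu> (cyl Y n y)"
      using C0_le_K by (intro mult_right_mono) auto
    then show "Gt n y \<le> K * measure \<nu> (cyl Y n y)" using Gt_bounds(1)[OF n, of y] by linarith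
    have "0 \<le> C0 * Gt n y" using Gt_bounds(2)[OF n, of y] measure_nonneg[of \<nu> "cyl Y n y"] by linarith
    then have "0 \<le> Gt n y" using C0 by (simp add: zero_le_mult_iff)
    then have "C0 * Gt n y \<le> K * Gt n y" using C0_le_K by (intro mult_right_mono) auto
    then show "measure \<nu> (cyl Y n y) \<le> K * Gt n y" using Gt_bounds(2)[OF n, of y] by linarith
    \<comment> \<open>A single lift suffices: the cylinder of \<open>x\<close> lies over that of
      \<open>y\<close>, so its \<open>\<mu>\<close>-mass already gives the lower bound.\<close>
    obtain x where x: "x \<in> X" "y = a \<circ> x" using y factor by blast
    show "c ^ n \<le> measure \<nu> (cyl Y n y)"
      unfolding x(2) using c(2)[OF n x(1)] nu_cyl_ge[OF x(1), of n] by linarith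
  next
    show "measure \<nu> (cyl Y (n + m) y) \<le> K * measure \<nu> (cyl Y n y) * measure \<nu> (cyl Y m ((shift ^^ n) y))"
      if "n \<ge> 1" "m \<ge> 1" for n m y using nu_quasi[OF that] .
    show "measure \<nu> A = 0 \<or> measure \<nu> A = 1"
      if "A \<in> sets \<nu>" "measure \<nu> (A - shift -` A) = 0" "measure \<nu> (shift -` A \<inter> Y - A) = 0" for A
      using ergodic_nu[OF that] .
  qed
  then show ?thesis by blast
qed

end

theorem theorem3p7:
  fixes k k' :: nat and X Y :: "(nat \<Rightarrow> nat) set" and a :: "nat \<Rightarrow> nat"
    and f :: "nat \<Rightarrow> (nat \<Rightarrow> nat) \<Rightarrow> real" and \<mu> :: "(nat \<Rightarrow> nat) measure"
  assumes "subshift k X" and "subshift k' Y" and "one_block_factor X Y a"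
    and "has_specification X"
    and "potential_seq X f" and "almost_additive X f" and "bounded_variation X f"
    and "invariant_measure X \<mu>" and "gibbs X f \<mu>"
    and "\<forall>\<mu>'. invariant_measure X \<mu>' \<and> gibbs X f \<mu>' \<longrightarrow> \<mu>' = \<mu>"
    and "equilibrium_state X f \<mu>"
    and "\<forall>\<mu>'. equilibrium_state X f \<mu>' \<longrightarrow> \<mu>' = \<mu>"
  shows "let \<nu> = distr \<mu> (restrict_space borel Y) (\<lambda>x. a \<circ> x); G = gtilde X Y a f in
     pressure Y G = 0 \<and>
     invariant_measure Y \<nu> \<and> gibbs Y G \<nu> \<and>
     (\<forall>\<nu>'. invariant_measure Y \<nu>' \<and> gibbs Y G \<nu>' \<longrightarrow> \<nu>' = \<nu>) \<and>
     equilibrium_state Y G \<nu> \<and>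
     (\<forall>\<nu>'. equilibrium_state Y G \<nu>' \<longrightarrow> \<nu>' = \<nu>)"
proof -
  obtain C where C: "C > 0" and aa: "\<And>n m x. n \<ge> 1 \<Longrightarrow> m \<ge> 1 \<Longrightarrow> x \<in> X \<Longrightarrow>
      exp (- C) * f n x * f m ((shift ^^ n) x) \<le> f (n + m) x \<and>
      f (n + m) x \<le> exp C * f n x * f m ((shift ^^ n) x)"
    using assms(6) unfolding almost_additive_def by blast
  obtain P C0 where g: "pressure X f = ereal P" "C0 > 0"
    "\<And>n x. n \<ge> 1 \<Longrightarrow> x \<in> X \<Longrightarrow> inverse C0 < measure \<mu> (cyl X n x) / (exp (- (real n * P)) * f n x)"
    "\<And>n x. n \<ge> 1 \<Longrightarrow> x \<in> X \<Longrightarrow> measure \<mu> (cyl X n x) / (exp (- (real n * P)) * f n x) < C0"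
    using assms(9) unfolding gibbs_def by blast
  have "factor_gibbs k X \<mu> k' Y a f P C C0"
  proof (intro factor_gibbs.intro invariant_subshift.intro factor_gibbs_axioms.intro)
    show "(\<lambda>x. a \<circ> x) ` X = Y" using assms(3) by (simp add: one_block_factor_def)
    show "f n x > 0" if "n \<ge> 1" "x \<in> X" for n x
      using assms(5) that unfolding potential_seq_def by blast
    fix n m :: nat and x assume nmx: "n \<ge> 1" "m \<ge> 1" "x \<in> X"
    have "exp C * (exp (- C) * (f n x * f m ((shift ^^ n) x))) \<le> exp C * f (n + m) x"
      using aa[OF nmx] by (intro mult_left_mono) (simp_all add: mult.assoc)
    then show "f n x * f m ((shift ^^ n) x) \<le> exp C * f (n + m) x"
      by (simp add: mult.assoc[symmetric] flip: exp_add)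
    show "f (n + m) x \<le> exp C * (f n x * f m ((shift ^^ n) x))"
      using aa[OF nmx] by (simp add: mult.assoc)
  qed (use assms g C in blast)+
  then interpret F: factor_gibbs k X \<mu> k' Y a f P C C0 .
  obtain c where "quasi_gibbs k' Y F.\<nu> F.Gt F.K c" using F.quasi_gibbs_nu by blast
  then interpret Q: quasi_gibbs k' Y F.\<nu> F.Gt F.K c .
  show ?thesis
    unfolding Let_def
    using Q.pressure_zero F.invariant_nu Q.gibbs_nu Q.unique_gibbs Q.invariant_iff
      Q.equilibrium_nu Q.unique_equilibrium by blast
qed

end
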